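(* Let $a,b,\mu\in\mathbb{R}$ and assume that $ab\ge 0$. Then the dynamics of the equation $x'=f(x)+\mu\sin t$ is one of the following: (1) The equation has a global center if and only if $a=b=0$. (2) If $b=0$ and $|\mu|<1$, the equation has a center and no limit cycles. (3) In any other case, the equation has exactly one limit cycle, which is the symmetric periodic solution $u^s(t)$. Moreover, the limit cycle is hyperbolic, globally asymptotically stable when $b<0$ and unstable when $b>0$.
   Context: For $a,b\in\mathbb{R}$, the function $f:\mathbb{R}\to\mathbb{R}$ is the continuous odd piecewise linear function $$f(x)=\begin{cases} ax+(a-b), & x\le -1,\\ bx, & -1<x<1,\\ ax+(b-a), & x\ge 1.\end{cases}$$ For $\mu\in\mathbb{R}$, consider the scalar $2\pi$-periodic differential equation $x'=f(x)+\mu\sin t$; let $u(t,\tau,x)$ be its solution with $u(\tau,\tau,x)=x$ (defined for all $t\in\mathbb{R}$). Put $P(x)=u(2\pi,0,x)$, $d(x)=P(x)-x$ and $Q(x)=-u(\pi,0,x)$. "Periodic solution" means $2\pi$-periodic solution, i.e. $d(x)=0$ for its value $x$ at $t=0$. A limit cycle is an isolated periodic solution, i.e. one whose value at $t=0$ is an isolated zero of $d$; a periodic solution $u(t,0,\bar x)$ is hyperbolic if $P'(\bar x)\ne 1$. The equation has a center if $d$ vanishes identically on an entire interval, and the center is global if $d$ is identically zero. The solution $u(t,0,x)$ is a symmetric periodic solution if $x$ is a fixed point of $Q$; the equation has exactly one symmetric periodic solution, denoted $u^s(t)$.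
   Formalization: Hyperbolicity of the limit cycle is claimed in case (3) except when b=0 and |μ|=1, where it fails: there u^s(t)=-μ cos t stays in [-1,1] and P'(u^s(0))=1, although it is the only limit cycle. *)

theory Defs
  imports "HOL-Analysis.Analysis"
begin

definition pl_field :: "real \<Rightarrow> real \<Rightarrow> real \<Rightarrow> real" where
  "pl_field a b x =
    (if x \<le> -1 then a * x + (a - b)
     else if x < 1 then b * x
     else a * x + (b - a))"

definition solves :: "real \<Rightarrow> real \<Rightarrow> real \<Rightarrow> (real \<Rightarrow> real) \<Rightarrow> bool" where
  "solves a b \<mu> v \<longleftrightarrow>
    (\<forall>t. (v has_real_derivative pl_field a b (v t) + \<mu> * sin t) (at t))"

text \<open>The value at time t of the solution through x at time \<tau>. The right-hand side is globally
  Lipschitz in x, so there is exactly one such solution on the whole line.\<close>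

definition flow :: "real \<Rightarrow> real \<Rightarrow> real \<Rightarrow> real \<Rightarrow> real \<Rightarrow> real \<Rightarrow> real" where
  "flow a b \<mu> t \<tau> x = (THE v. solves a b \<mu> v \<and> v \<tau> = x) t"

definition poincare_map :: "real \<Rightarrow> real \<Rightarrow> real \<Rightarrow> real \<Rightarrow> real" where
  "poincare_map a b \<mu> x = flow a b \<mu> (2 * pi) 0 x"

definition displacement :: "real \<Rightarrow> real \<Rightarrow> real \<Rightarrow> real \<Rightarrow> real" where
  "displacement a b \<mu> x = poincare_map a b \<mu> x - x"

definition half_map :: "real \<Rightarrow> real \<Rightarrow> real \<Rightarrow> real \<Rightarrow> real" where
  "half_map a b \<mu> x = - flow a b \<mu> pi 0 x"

definition periodic_solution :: "real \<Rightarrow> real \<Rightarrow> real \<Rightarrow> (real \<Rightarrow> real) \<Rightarrow> bool" where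
  "periodic_solution a b \<mu> v \<longleftrightarrow>
    (\<exists>x. displacement a b \<mu> x = 0 \<and> v = (\<lambda>t. flow a b \<mu> t 0 x))"

definition limit_cycle :: "real \<Rightarrow> real \<Rightarrow> real \<Rightarrow> (real \<Rightarrow> real) \<Rightarrow> bool" where
  "limit_cycle a b \<mu> v \<longleftrightarrow>
    (\<exists>x. x isolated_in {y. displacement a b \<mu> y = 0} \<and> v = (\<lambda>t. flow a b \<mu> t 0 x))"

definition symmetric_periodic_solution ::
    "real \<Rightarrow> real \<Rightarrow> real \<Rightarrow> (real \<Rightarrow> real) \<Rightarrow> bool" where
  "symmetric_periodic_solution a b \<mu> v \<longleftrightarrow>
    (\<exists>x. half_map a b \<mu> x = x \<and> v = (\<lambda>t. flow a b \<mu> t 0 x))"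

text \<open>Differentiability of the Poincare map at the initial value is part of hyperbolicity.\<close>

definition hyperbolic :: "real \<Rightarrow> real \<Rightarrow> real \<Rightarrow> (real \<Rightarrow> real) \<Rightarrow> bool" where
  "hyperbolic a b \<mu> v \<longleftrightarrow>
    periodic_solution a b \<mu> v \<and>
    (\<exists>D. (poincare_map a b \<mu> has_real_derivative D) (at (v 0)) \<and> D \<noteq> 1)"

definition has_center :: "real \<Rightarrow> real \<Rightarrow> real \<Rightarrow> bool" where
  "has_center a b \<mu> \<longleftrightarrow> (\<exists>l r. l < r \<and> (\<forall>x\<in>{l<..<r}. displacement a b \<mu> x = 0))"

definition has_global_center :: "real \<Rightarrow> real \<Rightarrow> real \<Rightarrow> bool" where
  "has_global_center a b \<mu> \<longleftrightarrow> (\<forall>x. displacement a b \<mu> x = 0)"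

text \<open>Stability in the sense of Lyapunov, for every initial time \<tau>.\<close>

definition lyapunov_stable :: "real \<Rightarrow> real \<Rightarrow> real \<Rightarrow> (real \<Rightarrow> real) \<Rightarrow> bool" where
  "lyapunov_stable a b \<mu> v \<longleftrightarrow>
    (\<forall>\<tau>. \<forall>\<epsilon>>0. \<exists>\<delta>>0. \<forall>x. \<bar>x - v \<tau>\<bar> < \<delta> \<longrightarrow>
      (\<forall>t\<ge>\<tau>. \<bar>flow a b \<mu> t \<tau> x - v t\<bar> < \<epsilon>))"

definition globally_asymptotically_stable ::
    "real \<Rightarrow> real \<Rightarrow> real \<Rightarrow> (real \<Rightarrow> real) \<Rightarrow> bool" where
  "globally_asymptotically_stable a b \<mu> v \<longleftrightarrow>
    lyapunov_stable a b \<mu> v \<and>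
    (\<forall>\<tau> x. ((\<lambda>t. flow a b \<mu> t \<tau> x - v t) \<longlongrightarrow> 0) at_top)"

definition unstable :: "real \<Rightarrow> real \<Rightarrow> real \<Rightarrow> (real \<Rightarrow> real) \<Rightarrow> bool" where
  "unstable a b \<mu> v \<longleftrightarrow> \<not> lyapunov_stable a b \<mu> v"

end

theory Submission
  imports Defs
begin

text \<open>The half-period map \<open>Q\<close> is continuous and strictly decreasing, so it has exactly one fixed point;
  the corresponding solution \<open>us\<close> satisfies \<open>us (t + \<pi>) = - us t\<close> and hence has a zero. Writing
  \<open>f x = a x + (b - a) clip x\<close>, the difference \<open>w\<close> of two solutions satisfies \<open>w' = (a + (b - a) q) w\<close>,
  where \<open>q\<close>, a difference quotient of \<open>clip\<close>, lies in \<open>[0, 1]\<close>. Since \<open>a b \<ge> 0\<close>, \<open>w\<^sup>2\<close> is monotone in time,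
  so for two distinct periodic solutions \<open>a + (b - a) q\<close> vanishes identically. If \<open>b \<noteq> 0\<close>, this is
  impossible at a zero of \<open>us\<close>. If \<open>b = 0 \<noteq> a\<close>, both solutions stay in the strip \<open>|x| \<le> 1\<close>, where they
  are explicit, and this needs \<open>|\<mu>| < 1\<close>. Near every zero of \<open>us\<close> the rate of change of \<open>w\<^sup>2\<close> is bounded
  away from 0 as long as \<open>w\<close> is, which yields attraction or repulsion, while dominated convergence
  in the difference quotients gives \<open>P'\<close> at \<open>us 0\<close> as the exponential of the integral of \<open>f' (us t)\<close>.\<close>

section \<open>Scalar differential equations\<close>

lemma antiderivative_vanishing_at_0:
  fixes h :: "real \<Rightarrow> real"
  assumes "continuous_on UNIV h"
  obtains H where "\<And>t. (H has_real_derivative h t) (at t)" "H 0 = 0"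
proof -
  have "\<exists>F. \<forall>x::real. -\<infinity> < ereal x \<longrightarrow> ereal x < \<infinity> \<longrightarrow> (F has_vector_derivative h x) (at x)"
    by (rule einterval_antiderivative) (use assms in \<open>auto simp: continuous_on_eq_continuous_at\<close>)
  then obtain F where F: "(F has_real_derivative h t) (at t)" for t
    by (auto simp: has_real_derivative_iff_has_vector_derivative)
  show thesis
  proof
    show "((\<lambda>t. F t - F 0) has_real_derivative h t) (at t)" for t
      using F[of t] by (auto intro!: derivative_eq_intros)
  qed simp
qed

text \<open>For nonnegative times both \<open>G - H\<close> and \<open>G + H\<close> are
  nondecreasing and start at 0. Negative times follow by applying this to the reflection of
  \<open>H\<close>.\<close>

lemma abs_le_of_abs_deriv_le:
  fixes H G :: "real \<Rightarrow> real"
  assumes H: "\<And>t. (H has_real_derivative h t) (at t)" "H 0 = 0"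
    and G: "\<And>t. (G has_real_derivative g t) (at t)" "G 0 = 0"
    and le: "\<And>t. \<bar>h t\<bar> \<le> g \<bar>t\<bar>"
  shows "\<bar>H t\<bar> \<le> G \<bar>t\<bar>"
proof -
  have nonneg: "\<bar>K t\<bar> \<le> G t" if "t \<ge> 0" and K: "\<And>s. (K has_real_derivative k s) (at s)" "K 0 = 0"
    and kle: "\<And>s. s \<ge> 0 \<Longrightarrow> \<bar>k s\<bar> \<le> g s" for K k t
  proof -
    have "G 0 - K 0 \<le> G t - K t"
    proof (rule DERIV_nonneg_imp_nondecreasing[OF \<open>t \<ge> 0\<close>])
      fix s :: real assume "0 \<le> s"
      then show "\<exists>y. ((\<lambda>s. G s - K s) has_real_derivative y) (at s) \<and> 0 \<le> y"
        using G(1)[of s] K(1)[of s] kle[of s] by (intro exI[of _ "g s - k s"]) (auto intro!: derivative_intros)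
    qed
    moreover have "G 0 + K 0 \<le> G t + K t"
    proof (rule DERIV_nonneg_imp_nondecreasing[OF \<open>t \<ge> 0\<close>])
      fix s :: real assume "0 \<le> s"
      then show "\<exists>y. ((\<lambda>s. G s + K s) has_real_derivative y) (at s) \<and> 0 \<le> y"
        using G(1)[of s] K(1)[of s] kle[of s] by (intro exI[of _ "g s + k s"]) (auto intro!: derivative_intros)
    qed
    ultimately show ?thesis using K(2) G(2) by auto
  qed
  show ?thesis
  proof (cases "t \<ge> 0")
    case True
    then show ?thesis using nonneg[OF True H] le by (metis abs_of_nonneg)
  next
    case False
    have "((\<lambda>s. H (- s)) has_real_derivative - h (- s)) (at s)" for s
      using H(1)[of "- s"] by (simp add: DERIV_mirror)
    from nonneg[OF _ this, of "-t"] False H(2) le show ?thesis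
      by (metis abs_minus_cancel abs_of_nonneg abs_of_neg linorder_not_le minus_minus neg_0_le_iff_le
          less_imp_le minus_zero)
  qed
qed

text \<open>Existence on the whole line comes from a single fixed point, with no continuation of
  local solutions: the unknown is \<open>y = u / e\<close>, sought among bounded continuous
  functions. Continuity of \<open>F\<close> is only demanded along continuous curves, which is all
  that the integral equation uses.\<close>

lemma ode_exists_at_0:
  fixes F :: "real \<Rightarrow> real \<Rightarrow> real"
  assumes cont: "\<And>u. continuous_on UNIV u \<Longrightarrow> continuous_on UNIV (\<lambda>t. F t (u t))"
    and lip: "\<And>t x y. \<bar>F t x - F t y\<bar> \<le> K * \<bar>x - y\<bar>"
    and bound: "\<And>t. \<bar>F t 0\<bar> \<le> M" and K: "K \<ge> 1"
  obtains u where "\<And>t. (u has_real_derivative F t (u t)) (at t)" "u 0 = 0"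
proof -
  have M: "M \<ge> 0" using bound[of 0] by linarith
  \<comment> \<open>With the weight \<open>exp (2 K |t|)\<close> the Picard operator is a 1/2-contraction on the whole line.\<close>
  define e where "e = (\<lambda>t::real. exp (2 * K * \<bar>t\<bar>))"
  have e_pos: "e t > 0" for t by (simp add: e_def)
  have e_cont: "continuous_on UNIV e" unfolding e_def by (intro continuous_intros)
  \<comment> \<open>\<open>A y\<close> is the integral from 0 of the right-hand side along the curve
    \<open>e * y\<close>; the choice is meaningful for continuous \<open>y\<close>.\<close>
  define A where "A y = (SOME H. (\<forall>t. (H has_real_derivative F t (e t * y t)) (at t)) \<and> H 0 = 0)"
    for y :: "real \<Rightarrow> real"
  have A: "(\<forall>t. (A y has_real_derivative F t (e t * y t)) (at t)) \<and> A y 0 = 0"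
    if "continuous_on UNIV y" for y
  proof -
    have "continuous_on UNIV (\<lambda>t. F t (e t * y t))"
      by (intro cont continuous_intros e_cont that)
    then obtain H where "\<And>t. (H has_real_derivative F t (e t * y t)) (at t)" "H 0 = 0"
      using antiderivative_vanishing_at_0 by blast
    then show ?thesis unfolding A_def by (intro someI_ex[of "\<lambda>H. (\<forall>t. (H has_real_derivative F t (e t * y t)) (at t)) \<and> H 0 = 0"]) blast
  qed
  have exp_deriv: "((\<lambda>t. C * (exp (2*K*t) - 1) / (2 * K)) has_real_derivative C * exp (2*K*t)) (at t)" for C t
    using K by (auto intro!: derivative_eq_intros simp: field_simps)
  \<comment> \<open>The integral of \<open>K * D * exp (2 * K * s)\<close> over
    \<open>[0, \<bar>t\<bar>]\<close> is \<open>D / 2 * (e t - 1)\<close>, so the factor 2 in the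
    exponent is what produces the contraction constant 1/2.\<close>
  have A_diff: "\<bar>A y t - A z t\<bar> \<le> D / 2 * e t"
    if y: "continuous_on UNIV y" and z: "continuous_on UNIV z" and D: "\<And>t. \<bar>y t - z t\<bar> \<le> D" for y z t D
  proof -
    have D0: "D \<ge> 0" using D[of 0] by linarith
    have "\<bar>A y t - A z t\<bar> \<le> K * D * (exp (2*K*\<bar>t\<bar>) - 1) / (2 * K)"
    proof (rule abs_le_of_abs_deriv_le[where H = "\<lambda>t. A y t - A z t" and G = "\<lambda>t. K * D * (exp (2*K*t) - 1) / (2 * K)"])
      show "((\<lambda>t. A y t - A z t) has_real_derivative F t (e t * y t) - F t (e t * z t)) (at t)" for t
        using A[OF y] A[OF z] by (auto intro!: derivative_intros)
      show "((\<lambda>t. K * D * (exp (2*K*t) - 1) / (2 * K)) has_real_derivative K * D * exp (2*K*t)) (at t)" for t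
        by (rule exp_deriv)
      fix t
      have "\<bar>F t (e t * y t) - F t (e t * z t)\<bar> \<le> K * \<bar>e t * y t - e t * z t\<bar>" by (rule lip)
      also have "\<bar>e t * y t - e t * z t\<bar> = e t * \<bar>y t - z t\<bar>"
        using e_pos[of t] by (simp add: abs_mult flip: right_diff_distrib)
      also have "K * (e t * \<bar>y t - z t\<bar>) \<le> K * (e t * D)"
        using K e_pos[of t] D[of t] by (intro mult_left_mono) auto
      finally show "\<bar>F t (e t * y t) - F t (e t * z t)\<bar> \<le> K * D * exp (2*K*\<bar>t\<bar>)"
        by (simp add: e_def mult_ac)
    qed (use A[OF y] A[OF z] in auto)
    also have "\<dots> = D / 2 * (e t - 1)" using K by (simp add: e_def field_simps)
    also have "\<dots> \<le> D / 2 * e t" using D0 by (intro mult_left_mono) auto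
    finally show ?thesis .
  qed
  \<comment> \<open>Together with \<open>A_diff\<close> against the zero function, this keeps
    \<open>A y / e\<close> bounded, so that \<open>T\<close> maps into the bounded continuous
    functions.\<close>
  have A_zero: "\<bar>A (\<lambda>_. 0) t\<bar> \<le> M * e t" for t
  proof -
    have "\<bar>A (\<lambda>_. 0) t\<bar> \<le> M * \<bar>t\<bar>"
    proof (rule abs_le_of_abs_deriv_le[where g = "\<lambda>_. M"])
      show "(A (\<lambda>_. 0) has_real_derivative F t 0) (at t)" for t
        using A[of "\<lambda>_. 0"] by simp
    qed (use A[of "\<lambda>_. 0"] bound in \<open>auto intro!: derivative_eq_intros\<close>)
    also have "\<bar>t\<bar> \<le> e t"
    proof -
      have "\<bar>t\<bar> * 1 \<le> \<bar>t\<bar> * (2 * K)" using K by (intro mult_left_mono) auto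
      also have "\<dots> \<le> e t" using exp_ge_add_one_self[of "2 * K * \<bar>t\<bar>"]
        unfolding e_def mult.commute[of "\<bar>t\<bar>"] by linarith
      finally show ?thesis by simp
    qed
    finally show ?thesis using M by (simp add: mult_left_mono)
  qed
  have A_cont: "continuous_on UNIV (\<lambda>t. A y t / e t)" if "continuous_on UNIV y" for y
  proof -
    have "continuous_on UNIV (A y)"
      using A[OF that] DERIV_isCont continuous_at_imp_continuous_on by blast
    then show ?thesis using e_cont e_pos by (intro continuous_intros) (auto simp: less_imp_neq[symmetric])
  qed
  define T where "T y = Bcontfun (\<lambda>t. A (apply_bcontfun y) t / e t)" for y :: "real \<Rightarrow>\<^sub>C real"
  have T: "apply_bcontfun (T y) t = A (apply_bcontfun y) t / e t" for y t
  proof -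
    have "\<bar>A (apply_bcontfun y) t / e t\<bar> \<le> dist y 0 / 2 + M" for t
    proof -
      have "\<bar>A (apply_bcontfun y) t - A (\<lambda>_. 0) t\<bar> \<le> dist y 0 / 2 * e t"
        by (rule A_diff) (use dist_bounded[of y _ 0] in \<open>auto simp: dist_real_def\<close>)
      then have "\<bar>A (apply_bcontfun y) t\<bar> \<le> (dist y 0 / 2 + M) * e t"
        using A_zero[of t] unfolding distrib_right by linarith
      then show ?thesis using e_pos[of t] by (simp add: pos_divide_le_eq)
    qed
    then have "bounded (range (\<lambda>t. A (apply_bcontfun y) t / e t))"
      by (intro boundedI[where B = "dist y 0 / 2 + M"]) auto
    then have "(\<lambda>t. A (apply_bcontfun y) t / e t) \<in> bcontfun"
      using A_cont[of "apply_bcontfun y"] by (simp add: bcontfun_def)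
    then show ?thesis unfolding T_def by (simp add: Bcontfun_inverse)
  qed
  have "\<exists>!y. T y = y"
  proof (rule banach_fix_type[of "1/2"])
    show "\<forall>y z. dist (T y) (T z) \<le> 1 / 2 * dist y z"
    proof (intro allI dist_bound)
      fix y z :: "real \<Rightarrow>\<^sub>C real" and t
      have "\<bar>A (apply_bcontfun y) t - A (apply_bcontfun z) t\<bar> \<le> dist y z / 2 * e t"
        by (rule A_diff) (use dist_bounded[of y _ z] in \<open>auto simp: dist_real_def\<close>)
      then show "dist (apply_bcontfun (T y) t) (apply_bcontfun (T z) t) \<le> 1 / 2 * dist y z"
        using e_pos[of t] by (simp add: T dist_real_def pos_divide_le_eq flip: diff_divide_distrib)
    qed
  qed auto
  then obtain y where y: "T y = y" by blast
  have eq: "e t * apply_bcontfun y t = A (apply_bcontfun y) t" for t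
    using T[of y t] e_pos[of t] unfolding y by simp
  show thesis
    using that[of "A (apply_bcontfun y)"] A[of "apply_bcontfun y"] by (simp add: eq)
qed

lemma ode_exists:
  fixes F :: "real \<Rightarrow> real \<Rightarrow> real"
  assumes cont: "\<And>u. continuous_on UNIV u \<Longrightarrow> continuous_on UNIV (\<lambda>t. F t (u t))"
    and lip: "\<And>t x y. \<bar>F t x - F t y\<bar> \<le> K * \<bar>x - y\<bar>"
    and bound: "\<And>t. \<bar>F t 0\<bar> \<le> M"
  obtains u where "\<And>t. (u has_real_derivative F t (u t)) (at t)" "u \<tau> = x"
proof -
  \<comment> \<open>The existence result at time 0 asks for a Lipschitz constant of at least
    1.\<close>
  define L where "L = max K 1"
  have lipL: "\<bar>F t x - F t y\<bar> \<le> L * \<bar>x - y\<bar>" for t x y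
    using lip[of t x y] mult_right_mono[of K L "\<bar>x - y\<bar>"] by (simp add: L_def)
  \<comment> \<open>Translating time by \<tau> and the state by x reduces to the value 0 at time 0;
    the bound at state 0 grows by \<open>L * \<bar>x\<bar>\<close>.\<close>
  define G where "G = (\<lambda>t y. F (t + \<tau>) (y + x))"
  obtain v where v: "\<And>t. (v has_real_derivative G t (v t)) (at t)" "v 0 = 0"
  proof (rule ode_exists_at_0[of G L "M + L * \<bar>x\<bar>"])
    fix u :: "real \<Rightarrow> real" assume u: "continuous_on UNIV u"
    have "continuous_on UNIV (\<lambda>t. F t (u (t - \<tau>) + x))"
      by (intro cont continuous_intros continuous_on_compose2[OF u]) auto
    then have "continuous_on UNIV (\<lambda>t. F (t + \<tau>) (u ((t + \<tau>) - \<tau>) + x))"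
      by (rule continuous_on_compose2) (intro continuous_intros, simp)
    then show "continuous_on UNIV (\<lambda>t. G t (u t))" by (simp add: G_def)
  next
    show "\<bar>G t 0\<bar> \<le> M + L * \<bar>x\<bar>" for t
      using bound[of "t + \<tau>"] lipL[of "t + \<tau>" x 0] by (simp add: G_def)
    show "\<bar>G t y - G t z\<bar> \<le> L * \<bar>y - z\<bar>" for t y z
      using lipL[of "t + \<tau>" "y + x" "z + x"] by (simp add: G_def)
  qed (auto simp: L_def)
  show thesis
  proof
    fix t
    have "((\<lambda>t. v (t - \<tau>)) has_real_derivative G (t - \<tau>) (v (t - \<tau>))) (at t)"
      using v(1)[of "t - \<tau>"] DERIV_shift[of v _ t "- \<tau>"] by simp
    then show "((\<lambda>t. v (t - \<tau>) + x) has_real_derivative F t (v (t - \<tau>) + x)) (at t)"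
      by (auto intro!: derivative_eq_intros simp: G_def)
  qed (simp add: v)
qed

text \<open>The square of \<open>w\<close> is used because it is differentiable even where
  \<open>w\<close> vanishes. Multiplied by \<open>exp (- 2 * K * t)\<close> it is nonincreasing and
  multiplied by \<open>exp (2 * K * t)\<close> it is nondecreasing, which covers both directions of
  time.\<close>

lemma Gronwall_abs:
  fixes w :: "real \<Rightarrow> real"
  assumes w: "\<And>t. (w has_real_derivative w' t) (at t)"
    and le: "\<And>t. \<bar>w' t\<bar> \<le> K * \<bar>w t\<bar>"
  shows "\<bar>w t\<bar> \<le> \<bar>w s\<bar> * exp (K * \<bar>t - s\<bar>)"
proof -
  have bd: "\<bar>w t * w' t\<bar> \<le> K * (w t)\<^sup>2" for t
    using mult_left_mono[OF le[of t], of "\<bar>w t\<bar>"] by (simp add: abs_mult power2_eq_square mult_ac)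
  have "(w t)\<^sup>2 \<le> (w s)\<^sup>2 * exp (2 * K * \<bar>t - s\<bar>)"
  proof (cases "s \<le> t")
    case True
    have "(w t)\<^sup>2 * exp (- 2 * K * t) \<le> (w s)\<^sup>2 * exp (- 2 * K * s)"
    proof (rule DERIV_nonpos_imp_nonincreasing[OF True])
      fix r
      have "((\<lambda>t. (w t)\<^sup>2 * exp (- 2 * K * t)) has_real_derivative
          2 * (w r * w' r - K * (w r)\<^sup>2) * exp (- 2 * K * r)) (at r)"
        by (auto intro!: derivative_eq_intros w simp: algebra_simps)
      moreover have "2 * (w r * w' r - K * (w r)\<^sup>2) * exp (- 2 * K * r) \<le> 0"
        by (rule mult_nonpos_nonneg) (use abs_le_D1[OF bd[of r]] in simp_all)
      ultimately show "\<exists>y. ((\<lambda>t. (w t)\<^sup>2 * exp (- 2 * K * t)) has_real_derivative y) (at r) \<and> y \<le> 0" by blast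
    qed
    from mult_right_mono[OF this, of "exp (2 * K * t)"]
    have "(w t)\<^sup>2 \<le> (w s)\<^sup>2 * (exp (- 2 * K * s) * exp (2 * K * t))"
      by (simp add: mult.assoc exp_minus)
    also have "exp (- 2 * K * s) * exp (2 * K * t) = exp (2 * K * \<bar>t - s\<bar>)"
      using True unfolding exp_add[symmetric] by (simp add: right_diff_distrib)
    finally show ?thesis .
  next
    case False
    then have "t \<le> s" by simp
    then have "(w t)\<^sup>2 * exp (2 * K * t) \<le> (w s)\<^sup>2 * exp (2 * K * s)"
    proof (rule DERIV_nonneg_imp_nondecreasing)
      fix r
      have "((\<lambda>t. (w t)\<^sup>2 * exp (2 * K * t)) has_real_derivative
          2 * (w r * w' r + K * (w r)\<^sup>2) * exp (2 * K * r)) (at r)"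
        by (auto intro!: derivative_eq_intros w simp: algebra_simps)
      moreover have "2 * (w r * w' r + K * (w r)\<^sup>2) * exp (2 * K * r) \<ge> 0"
        by (rule mult_nonneg_nonneg) (use abs_le_D2[OF bd[of r]] in simp_all)
      ultimately show "\<exists>y. ((\<lambda>t. (w t)\<^sup>2 * exp (2 * K * t)) has_real_derivative y) (at r) \<and> 0 \<le> y" by blast
    qed
    from mult_right_mono[OF this, of "exp (- 2 * K * t)"]
    have "(w t)\<^sup>2 \<le> (w s)\<^sup>2 * (exp (2 * K * s) * exp (- 2 * K * t))"
      by (simp add: mult.assoc exp_minus)
    also have "exp (2 * K * s) * exp (- 2 * K * t) = exp (2 * K * \<bar>t - s\<bar>)"
      using False unfolding exp_add[symmetric] by (simp add: right_diff_distrib)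
    finally show ?thesis .
  qed
  also have "\<dots> = (\<bar>w s\<bar> * exp (K * \<bar>t - s\<bar>))\<^sup>2"
    unfolding power_mult_distrib power2_abs exp_double[symmetric] by (simp add: mult.assoc)
  finally show ?thesis
    using abs_le_square_iff[of "w t" "\<bar>w s\<bar> * exp (K * \<bar>t - s\<bar>)"] by (simp add: abs_mult)
qed

text \<open>Difference quotients tend to a nonzero limit at each point of the set, so the point is
  isolated in the level. A set that is negligible near each of its points is negligible.\<close>

lemma negligible_level_set_of_nonzero_deriv:
  fixes h :: "real \<Rightarrow> real"
  assumes "\<And>t. (h has_real_derivative h' t) (at t)"
  shows "negligible {t. h t = c \<and> h' t \<noteq> 0}" (is "negligible ?S")
proof -
  have "\<exists>U. openin (top_of_set ?S) U \<and> x \<in> U \<and> negligible U" if x: "x \<in> ?S" for x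
  proof -
    have "\<forall>\<^sub>F y in at x. (h y - h x) / (y - x) \<noteq> 0"
      using assms[of x] x by (intro tendsto_imp_eventually_ne[where c = "h' x"]) (auto simp: has_field_derivative_iff)
    then obtain U where U: "open U" "x \<in> U" "\<And>y. y \<in> U \<Longrightarrow> y \<noteq> x \<Longrightarrow> h y \<noteq> h x"
      by (auto simp: eventually_at_topological)
    then have "?S \<inter> U = {x}" using x by auto
    then show ?thesis using U by (metis insertI1 negligible_sing openin_open_Int)
  qed
  then show ?thesis by (intro locally_negligible_alt[THEN iffD2] ballI)
qed

section \<open>The flow and its symmetries\<close>

definition clip :: "real \<Rightarrow> real" where
  "clip x = max (-1) (min 1 x)"

text \<open>On the diagonal division by zero gives 0. This default stays within
  \<open>[0, 1]\<close> and is harmless in \<open>pl_field_diff\<close>, where the quotient is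
  multiplied by \<open>x - y\<close>.\<close>

definition clip_slope :: "real \<Rightarrow> real \<Rightarrow> real" where
  "clip_slope x y = (clip x - clip y) / (x - y)"

lemma continuous_on_clip [continuous_intros]:
  "continuous_on A g \<Longrightarrow> continuous_on A (\<lambda>x. clip (g x))"
  unfolding clip_def by (intro continuous_intros)

lemma pl_field_eq_clip: "pl_field a b x = a * x + (b - a) * clip x"
  by (auto simp: pl_field_def clip_def max_def min_def algebra_simps)

lemma clip_slope_bounds: "0 \<le> clip_slope x y" "clip_slope x y \<le> 1"
proof -
  have "0 \<le> clip_slope x y \<and> clip_slope x y \<le> 1" if "y < x" for x y
    using that by (auto simp: clip_slope_def clip_def max_def min_def divide_simps)
  from this[of x y] this[of y x] show "0 \<le> clip_slope x y" "clip_slope x y \<le> 1"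
    by (cases x y rule: linorder_cases;
      simp add: clip_slope_def minus_divide_divide[of "clip x - clip y" "x - y", symmetric])+
qed

lemma clip_slope_eq_0D: "clip_slope x 0 = 0 \<Longrightarrow> x = 0"
  by (auto simp: clip_slope_def clip_def max_def min_def split: if_splits)

text \<open>A chord of slope 1 has both ends in the strip where \<open>clip\<close> is the identity;
  \<open>x = y\<close> cannot occur, since the default value is 0.\<close>

lemma clip_slope_eq_1D:
  assumes "clip_slope x y = 1" shows "\<bar>x\<bar> \<le> 1" "\<bar>y\<bar> \<le> 1"
  using assms by (auto simp: clip_slope_def clip_def max_def min_def divide_simps split: if_splits)

text \<open>The point y is at least 1/2 away from both corners, so clipping cannot bring x closer to
  y than \<open>L \<le> 1/2\<close>. As \<open>clip\<close> is nondecreasing, the left side equals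
  \<open>\<bar>clip x - clip y\<bar> * \<bar>x - y\<bar>\<close>.\<close>

lemma clip_slope_ge:
  assumes "\<bar>y\<bar> \<le> 1/2" "\<bar>x - y\<bar> \<ge> L" "0 < L" "L \<le> 1/2"
  shows "clip_slope x y * (x - y)\<^sup>2 \<ge> L\<^sup>2"
proof -
  have "\<bar>clip x - clip y\<bar> \<ge> L" and "(clip x - clip y) * (x - y) \<ge> 0"
    using assms by (auto simp: clip_def max_def min_def abs_if split: if_splits intro: mult_nonneg_nonneg mult_nonpos_nonpos)
  then have "L * L \<le> \<bar>clip x - clip y\<bar> * \<bar>x - y\<bar>"
    using assms by (intro mult_mono) auto
  also have "\<dots> = clip_slope x y * (x - y)\<^sup>2"
    using \<open>(clip x - clip y) * (x - y) \<ge> 0\<close>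
    by (simp add: clip_slope_def power2_eq_square flip: abs_mult)
  finally show ?thesis by (simp add: power2_eq_square)
qed

lemma pl_field_diff:
  "pl_field a b x - pl_field a b y = (a + (b - a) * clip_slope x y) * (x - y)"
  by (cases "x = y") (simp_all add: pl_field_eq_clip clip_slope_def field_simps)

lemma abs_slope_le: "\<bar>a + (b - a) * clip_slope x y\<bar> \<le> \<bar>a\<bar> + \<bar>b - a\<bar>"
proof -
  have "\<bar>(b - a) * clip_slope x y\<bar> \<le> \<bar>b - a\<bar> * 1"
    unfolding abs_mult using clip_slope_bounds[of x y] by (intro mult_left_mono) auto
  then show ?thesis by (intro order_trans[OF abs_triangle_ineq]) simp
qed

lemma pl_field_lipschitz:
  "\<bar>pl_field a b x - pl_field a b y\<bar> \<le> (\<bar>a\<bar> + \<bar>b - a\<bar>) * \<bar>x - y\<bar>"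
  unfolding pl_field_diff abs_mult by (intro mult_right_mono abs_slope_le) auto

lemma pl_field_uminus: "pl_field a b (- x) = - pl_field a b x"
  by (auto simp: pl_field_def)

section \<open>Uniqueness, existence and order of solutions\<close>

lemma solves_diff_deriv:
  assumes "solves a b \<mu> u" "solves a b \<mu> v"
  shows "((\<lambda>t. u t - v t) has_real_derivative
    (a + (b - a) * clip_slope (u t) (v t)) * (u t - v t)) (at t)"
proof -
  have "((\<lambda>t. u t - v t) has_real_derivative
      (pl_field a b (u t) + \<mu> * sin t) - (pl_field a b (v t) + \<mu> * sin t)) (at t)"
    using assms unfolding solves_def by (intro derivative_intros) auto
  then show ?thesis by (simp add: pl_field_diff)
qed

lemma solves_diff_bound:
  assumes "solves a b \<mu> u" "solves a b \<mu> v"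
  shows "\<bar>u t - v t\<bar> \<le> \<bar>u s - v s\<bar> * exp ((\<bar>a\<bar> + \<bar>b - a\<bar>) * \<bar>t - s\<bar>)"
  using Gronwall_abs[OF solves_diff_deriv[OF assms]] abs_slope_le
  by (simp add: abs_mult mult_right_mono)

lemma solves_unique:
  assumes "solves a b \<mu> u" "solves a b \<mu> v" "u s = v s"
  shows "u = v"
  using solves_diff_bound[OF assms(1,2), of _ s] assms(3) by auto

lemma solves_exists: "\<exists>v. solves a b \<mu> v \<and> v \<tau> = x"
proof -
  obtain u where "\<And>t. (u has_real_derivative pl_field a b (u t) + \<mu> * sin t) (at t)" "u \<tau> = x"
  proof (rule ode_exists[where F = "\<lambda>t x. pl_field a b x + \<mu> * sin t" and K = "\<bar>a\<bar> + \<bar>b - a\<bar>" and M = "\<bar>\<mu>\<bar>"])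
    show "continuous_on UNIV (\<lambda>t. pl_field a b (u t) + \<mu> * sin t)" if "continuous_on UNIV u" for u
      unfolding pl_field_eq_clip by (intro continuous_intros that)
    show "\<bar>pl_field a b 0 + \<mu> * sin t\<bar> \<le> \<bar>\<mu>\<bar>" for t
      by (simp add: pl_field_def abs_mult mult_left_le)
  qed (use pl_field_lipschitz in auto)
  then show ?thesis unfolding solves_def by blast
qed

lemma flow_eq:
  assumes "solves a b \<mu> v"
  shows "flow a b \<mu> t \<tau> (v \<tau>) = v t"
proof -
  have "(THE u. solves a b \<mu> u \<and> u \<tau> = v \<tau>) = v"
    using assms solves_unique by (intro the_equality) auto
  then show ?thesis by (simp add: flow_def)
qed

lemma solves_flow: "solves a b \<mu> (\<lambda>t. flow a b \<mu> t \<tau> x)"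
  and flow_initial [simp]: "flow a b \<mu> \<tau> \<tau> x = x"
  using solves_exists[of a b \<mu> \<tau> x] flow_eq by (auto simp: flow_eq eta_contract_eq)

lemma solves_continuous_on: "solves a b \<mu> v \<Longrightarrow> continuous_on S v"
  unfolding solves_def by (meson DERIV_isCont continuous_at_imp_continuous_on)

lemma solves_neq:
  assumes "solves a b \<mu> u" "solves a b \<mu> v" "u s \<noteq> v s"
  shows "u t \<noteq> v t"
  using solves_unique[OF assms(1,2)] assms(3) by blast

text \<open>A reversal of order would make the continuous difference vanish at some time, against
  uniqueness.\<close>

lemma solves_less:
  assumes u: "solves a b \<mu> u" and v: "solves a b \<mu> v" and less: "u s < v s"
  shows "u t < v t"
proof (rule ccontr)
  assume "\<not> u t < v t"
  have "connected ((\<lambda>r. u r - v r) ` UNIV)"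
    using u v by (intro connected_continuous_image continuous_intros solves_continuous_on) auto
  then have "0 \<in> (\<lambda>r. u r - v r) ` UNIV"
    using less \<open>\<not> u t < v t\<close> connectedD_interval[of _ "u s - v s" "u t - v t" 0] by auto
  then obtain r where "u r = v r" by auto
  then show False using solves_neq[OF u v, of s r] less by simp
qed

section \<open>Time shifts and the half-period map\<close>

lemma solves_shift_period:
  assumes "solves a b \<mu> v" shows "solves a b \<mu> (\<lambda>t. v (t + 2 * pi))"
  using assms unfolding solves_def DERIV_shift[symmetric] by (metis sin_periodic)

text \<open>The field is odd and \<open>sin (t + pi) = - sin t\<close>, so the equation is invariant
  under \<open>(t, x) \<mapsto> (t + pi, - x)\<close>.\<close>

lemma solves_shift_half_period:
  assumes "solves a b \<mu> v" shows "solves a b \<mu> (\<lambda>t. - v (t + pi))"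
  unfolding solves_def
proof
  fix t
  have "((\<lambda>t. v (t + pi)) has_real_derivative pl_field a b (v (t + pi)) + \<mu> * sin (t + pi)) (at t)"
    using assms unfolding solves_def DERIV_shift[symmetric] by blast
  then show "((\<lambda>t. - v (t + pi)) has_real_derivative pl_field a b (- v (t + pi)) + \<mu> * sin t) (at t)"
    using DERIV_minus by (fastforce simp: pl_field_uminus)
qed

lemma displacement_eq_0_iff:
  "displacement a b \<mu> x = 0 \<longleftrightarrow> flow a b \<mu> (2 * pi) 0 x = x"
  by (simp add: displacement_def poincare_map_def)

lemma solves_periodic:
  assumes "solves a b \<mu> v" "v (2 * pi) = v 0"
  shows "v (t + 2 * pi * real n) = v t"
proof (induction n)
  case (Suc n)
  have "(\<lambda>t. v (t + 2 * pi)) = v"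
    using solves_unique[OF solves_shift_period[OF assms(1)] assms(1), of 0] assms(2) by simp
  from fun_cong[OF this, of "t + 2 * pi * real n"]
  have "v ((t + 2 * pi * real n) + 2 * pi) = v (t + 2 * pi * real n)" .
  then show ?case using Suc by (simp add: algebra_simps)
qed simp

lemma continuous_on_half_map: "continuous_on UNIV (half_map a b \<mu>)"
proof (rule lipschitz_on_continuous_on)
  show "(exp ((\<bar>a\<bar> + \<bar>b - a\<bar>) * pi))-lipschitz_on UNIV (half_map a b \<mu>)"
  proof (rule lipschitz_onI)
    fix x y
    show "dist (half_map a b \<mu> x) (half_map a b \<mu> y) \<le> exp ((\<bar>a\<bar> + \<bar>b - a\<bar>) * pi) * dist x y"
      using solves_diff_bound[OF solves_flow[of a b \<mu> 0 x] solves_flow[of a b \<mu> 0 y], of pi 0]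
      by (simp add: half_map_def dist_real_def abs_minus_commute mult.commute)
  qed simp
qed

lemma half_map_less: "x < y \<Longrightarrow> half_map a b \<mu> y < half_map a b \<mu> x"
  using solves_less[OF solves_flow[of a b \<mu> 0 x] solves_flow[of a b \<mu> 0 y], of 0 pi]
  by (simp add: half_map_def)

lemma half_map_fixed_point: "\<exists>!x. half_map a b \<mu> x = x"
proof -
  define y where "y = half_map a b \<mu> 0"
  define g where "g = (\<lambda>x. half_map a b \<mu> x - x)"
  have mono: "x \<le> z \<Longrightarrow> half_map a b \<mu> z \<le> half_map a b \<mu> x" for x z
    using half_map_less[of x z a b \<mu>] by (cases "x = z") auto
  have g: "continuous_on UNIV g"
    unfolding g_def by (intro continuous_intros continuous_on_half_map)
  \<comment> \<open>By definition \<open>g 0 = y\<close>, while \<open>g y\<close> is the difference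
    of the half-period map at y and at 0; since the map decreases, the two have opposite
    signs.\<close>
  have "g 0 \<le> 0 \<and> g y \<ge> 0 \<or> g 0 \<ge> 0 \<and> g y \<le> 0"
    using mono[of 0 y] mono[of y 0] by (cases "0 \<le> y") (simp_all add: g_def y_def[symmetric])
  moreover have "connected (g ` UNIV)" using g by (intro connected_continuous_image) auto
  ultimately have "0 \<in> g ` UNIV"
    using connectedD_interval[of "g ` UNIV" "g 0" "g y" 0] connectedD_interval[of "g ` UNIV" "g y" "g 0" 0] by blast
  then obtain x where "half_map a b \<mu> x = x" by (auto simp: g_def)
  moreover have "z = x" if "half_map a b \<mu> z = z" for z
    using half_map_less[of x z a b \<mu>] half_map_less[of z x a b \<mu>] that calculation
    by (cases x z rule: linorder_cases) auto
  ultimately show ?thesis by blast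
qed

text \<open>The reflected half-period shift is again a solution, and its value at 0 is
  \<open>half_map a b \<mu> x = x\<close>, so uniqueness applies.\<close>

lemma half_map_fixed_point_solution:
  assumes "half_map a b \<mu> x = x"
  shows "flow a b \<mu> (t + pi) 0 x = - flow a b \<mu> t 0 x"
proof -
  have "(\<lambda>t. - flow a b \<mu> (t + pi) 0 x) = (\<lambda>t. flow a b \<mu> t 0 x)"
    using solves_unique[OF solves_shift_half_period[OF solves_flow] solves_flow, of a b \<mu> 0 0 x 0 x] assms
    by (simp add: half_map_def)
  then show ?thesis by (metis minus_minus)
qed

lemma half_map_fixed_point_periodic:
  assumes "half_map a b \<mu> x = x"
  shows "flow a b \<mu> (2 * pi) 0 x = x"
  using half_map_fixed_point_solution[OF assms, of 0] half_map_fixed_point_solution[OF assms, of pi] by simp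

lemma half_map_fixed_point_zero:
  assumes "half_map a b \<mu> x = x"
  obtains t where "0 \<le> t" "t \<le> pi" "flow a b \<mu> t 0 x = 0"
proof -
  let ?u = "\<lambda>t. flow a b \<mu> t 0 x"
  have "connected (?u ` {0..pi})"
    using solves_flow by (intro connected_continuous_image solves_continuous_on) auto
  moreover have "?u 0 \<in> ?u ` {0..pi}" "?u pi \<in> ?u ` {0..pi}" by (intro imageI; simp)+
  moreover have "?u pi = - ?u 0" using half_map_fixed_point_solution[OF assms, of 0] by simp
  then have "?u 0 \<le> 0 \<and> 0 \<le> ?u pi \<or> ?u pi \<le> 0 \<and> 0 \<le> ?u 0" by linarith
  ultimately have "0 \<in> ?u ` {0..pi}"
    using connectedD_interval[of "?u ` {0..pi}" _ _ 0] by blast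
  then show thesis using that by auto
qed

section \<open>Monotonicity of the squared difference of two solutions\<close>

lemma solves_square_diff_deriv:
  assumes "solves a b \<mu> u" "solves a b \<mu> v"
  shows "((\<lambda>t. (u t - v t)\<^sup>2) has_real_derivative
    2 * (a + (b - a) * clip_slope (u t) (v t)) * (u t - v t)\<^sup>2) (at t)"
  by (rule DERIV_cong[OF DERIV_power[OF solves_diff_deriv[OF assms, of t], of 2]])
    (simp add: power2_eq_square algebra_simps)

text \<open>The slope is the convex combination \<open>a * (1 - q) + b * q\<close>. The factor
  \<sigma> carries the common sign of a and b, so that expanding and contracting equations are
  treated at once. Retaining the b term gives the quantitative bound needed near zeros of the
  symmetric solution.\<close>

lemma slope_nonneg:
  fixes \<sigma> a b :: real
  assumes "\<sigma> * a \<ge> 0" "\<sigma> * b \<ge> 0"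
  shows "\<sigma> * (a + (b - a) * clip_slope x y) \<ge> \<sigma> * b * clip_slope x y"
    "\<sigma> * (a + (b - a) * clip_slope x y) \<ge> 0"
proof -
  have eq: "\<sigma> * (a + (b - a) * clip_slope x y) = \<sigma> * a * (1 - clip_slope x y) + \<sigma> * b * clip_slope x y"
    by (simp add: algebra_simps)
  have "\<sigma> * a * (1 - clip_slope x y) \<ge> 0" "\<sigma> * b * clip_slope x y \<ge> 0"
    by (rule mult_nonneg_nonneg; use assms clip_slope_bounds[of x y] in simp)+
  then show "\<sigma> * (a + (b - a) * clip_slope x y) \<ge> \<sigma> * b * clip_slope x y"
    "\<sigma> * (a + (b - a) * clip_slope x y) \<ge> 0" unfolding eq by auto
qed

lemma square_diff_mono:
  assumes \<sigma>: "\<sigma> * a \<ge> 0" "\<sigma> * b \<ge> 0" and uv: "solves a b \<mu> u" "solves a b \<mu> v" and st: "s \<le> t"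
  shows "\<sigma> * (u s - v s)\<^sup>2 \<le> \<sigma> * (u t - v t)\<^sup>2"
proof (rule DERIV_nonneg_imp_nondecreasing[OF st])
  fix r
  have "0 \<le> 2 * (\<sigma> * (a + (b - a) * clip_slope (u r) (v r))) * (u r - v r)\<^sup>2"
    by (intro mult_nonneg_nonneg[OF mult_nonneg_nonneg] slope_nonneg(2)[OF \<sigma>]) simp_all
  with DERIV_cmult[OF solves_square_diff_deriv[OF uv, of r], of \<sigma>]
  show "\<exists>y. ((\<lambda>t. \<sigma> * (u t - v t)\<^sup>2) has_real_derivative y) (at r) \<and> 0 \<le> y"
    by (intro exI conjI) (assumption, simp add: mult_ac)
qed

text \<open>A function that is both monotone and periodic is constant. Its derivative is then 0, and
  the squared difference can be cancelled because distinct solutions never meet.\<close>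

lemma periodic_solutions_slope_eq_0:
  assumes \<sigma>: "\<sigma> * a \<ge> 0" "\<sigma> * b \<ge> 0" "\<sigma> \<noteq> 0" and uv: "solves a b \<mu> u" "solves a b \<mu> v"
    and per: "u (2 * pi) = u 0" "v (2 * pi) = v 0" and neq: "u s \<noteq> v s"
  shows "a + (b - a) * clip_slope (u t) (v t) = 0"
proof -
  define W where "W = (\<lambda>t. (u t - v t)\<^sup>2)"
  \<comment> \<open>Moving r' forward by enough whole periods puts it after r, so monotonicity
    compares any two times in both orders.\<close>
  have le: "\<sigma> * W r \<le> \<sigma> * W r'" for r r'
  proof -
    obtain n :: nat where "(r - r') / (2 * pi) \<le> real n" using real_arch_simple by blast
    then have "r \<le> r' + 2 * pi * real n" by (simp add: field_simps)
    from square_diff_mono[OF \<sigma>(1,2) uv this] show ?thesis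
      by (simp add: W_def solves_periodic[OF uv(1) per(1)] solves_periodic[OF uv(2) per(2)])
  qed
  have "W r = W t" for r using le[of r t] le[of t r] \<sigma>(3) by simp
  then have "W = (\<lambda>_. W t)" by auto
  then have "(W has_real_derivative 0) (at t)" using DERIV_const by metis
  then have "2 * (a + (b - a) * clip_slope (u t) (v t)) * (u t - v t)\<^sup>2 = 0"
    using DERIV_unique[OF solves_square_diff_deriv[OF uv, of t]] by (auto simp: W_def)
  then show ?thesis using solves_neq[OF uv neq, of t] by simp
qed

section \<open>The derivative of the Poincare map\<close>

text \<open>Distinct solutions never meet, so the slope \<open>g\<close> is continuous in time and
  the linear equation for their difference is solved exactly by the integrating factor
  \<open>exp (- G t)\<close>.\<close>

lemma poincare_map_quotient:
  fixes a b \<mu> x y :: real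
  assumes "x \<noteq> y"
  defines "g \<equiv> \<lambda>t. a + (b - a) * clip_slope (flow a b \<mu> t 0 x) (flow a b \<mu> t 0 y)"
  shows "g integrable_on {0..2 * pi}"
    and "(poincare_map a b \<mu> x - poincare_map a b \<mu> y) / (x - y) = exp (integral {0..2 * pi} g)"
proof -
  define u where "u = (\<lambda>t. flow a b \<mu> t 0 x)"
  define v where "v = (\<lambda>t. flow a b \<mu> t 0 y)"
  have uv: "solves a b \<mu> u" "solves a b \<mu> v" unfolding u_def v_def by (rule solves_flow)+
  have init: "u 0 = x" "v 0 = y" by (simp_all add: u_def v_def)
  have "u t - v t \<noteq> 0" for t using solves_neq[OF uv, of 0 t] init assms(1) by simp
  then have "continuous_on UNIV g"
    unfolding g_def clip_slope_def u_def[symmetric, THEN fun_cong] v_def[symmetric, THEN fun_cong]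
    by (intro continuous_intros solves_continuous_on[OF uv(1)] solves_continuous_on[OF uv(2)]) auto
  then obtain G where G: "\<And>t. (G has_real_derivative g t) (at t)" "G 0 = 0"
    using antiderivative_vanishing_at_0 by blast
  have "(g has_integral (G (2 * pi) - G 0)) {0..2 * pi}"
    by (rule fundamental_theorem_of_calculus)
      (auto intro: DERIV_subset[OF G(1)] simp flip: has_real_derivative_iff_has_vector_derivative)
  then have int: "g integrable_on {0..2 * pi}" "integral {0..2 * pi} g = G (2 * pi)"
    using G(2) by (auto simp: integrable_on_def intro: integral_unique)
  show "g integrable_on {0..2 * pi}" by (rule int)
  have w: "((\<lambda>t. u t - v t) has_real_derivative g t * (u t - v t)) (at t)" for t
    using solves_diff_deriv[OF uv, of t] by (simp add: g_def u_def v_def)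
  have "((\<lambda>t. exp (- G t)) has_real_derivative - g t * exp (- G t)) (at t)" for t
    by (auto intro!: derivative_eq_intros G(1))
  from DERIV_mult[OF w this] have "((\<lambda>t. (u t - v t) * exp (- G t)) has_real_derivative 0) (at t)" for t
    by (rule DERIV_cong) (simp add: algebra_simps)
  then have "(u (2 * pi) - v (2 * pi)) * exp (- G (2 * pi)) = (u 0 - v 0) * exp (- G 0)"
    using DERIV_isconst_all by blast
  then have "u (2 * pi) - v (2 * pi) = (x - y) * exp (G (2 * pi))"
    using G(2) init by (simp add: exp_minus field_simps)
  then show "(poincare_map a b \<mu> x - poincare_map a b \<mu> y) / (x - y) = exp (integral {0..2 * pi} g)"
    using assms(1) by (simp add: int poincare_map_def u_def v_def)
qed

text \<open>Off the corners \<open>clip\<close> is affine near y, so the quotients are eventually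
  constant; \<open>X n \<noteq> y\<close> keeps the default value 0 out of the inner case.\<close>

lemma clip_slope_tendsto:
  assumes "X \<longlonglongrightarrow> y" "\<And>n. X n \<noteq> y" "\<bar>y\<bar> \<noteq> 1"
  shows "(\<lambda>n. clip_slope (X n) y) \<longlonglongrightarrow> (if \<bar>y\<bar> < 1 then 1 else 0)"
proof (rule tendsto_eventually)
  consider "-1 < y" "y < 1" | "1 < y" | "y < -1" using assms(3) by linarith
  then show "\<forall>\<^sub>F n in sequentially. clip_slope (X n) y = (if \<bar>y\<bar> < 1 then 1 else 0)"
  proof cases
    case 1
    from order_tendstoD(1)[OF assms(1) 1(1)] order_tendstoD(2)[OF assms(1) 1(2)] show ?thesis
      by eventually_elim (use 1 assms(2) in \<open>auto simp: clip_slope_def clip_def\<close>)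
  next
    case 2
    from order_tendstoD(1)[OF assms(1) 2] show ?thesis
      by eventually_elim (use 2 in \<open>auto simp: clip_slope_def clip_def\<close>)
  next
    case 3
    from order_tendstoD(2)[OF assms(1) 3] show ?thesis
      by eventually_elim (use 3 in \<open>auto simp: clip_slope_def clip_def\<close>)
  qed
qed

lemma flow_tendsto:
  assumes "X \<longlonglongrightarrow> x"
  shows "(\<lambda>n. flow a b \<mu> t \<tau> (X n)) \<longlonglongrightarrow> flow a b \<mu> t \<tau> x"
proof -
  define C where "C = exp ((\<bar>a\<bar> + \<bar>b - a\<bar>) * \<bar>t - \<tau>\<bar>)"
  have "(\<lambda>n. \<bar>X n - x\<bar> * C) \<longlonglongrightarrow> 0"
    using tendsto_mult_left_zero[OF tendsto_rabs_zero[OF LIM_zero[OF assms]], of C] .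
  then have "(\<lambda>n. flow a b \<mu> t \<tau> (X n) - flow a b \<mu> t \<tau> x) \<longlonglongrightarrow> 0"
  proof (rule Lim_null_comparison[rotated])
    show "\<forall>\<^sub>F n in sequentially. norm (flow a b \<mu> t \<tau> (X n) - flow a b \<mu> t \<tau> x) \<le> \<bar>X n - x\<bar> * C"
      using solves_diff_bound[OF solves_flow solves_flow, of a b \<mu> t \<tau> _ \<tau> x \<tau>]
      by (intro always_eventually) (simp add: C_def)
  qed
  then show ?thesis by (rule LIM_zero_cancel)
qed

text \<open>The slopes in the exact quotient formula converge to the derivative of the field except
  at times when the solution sits on a corner, and \<open>null\<close> makes those times negligible.
  The value of \<open>h\<close> there does not affect the integral.\<close>

lemma poincare_map_has_derivative:
  fixes a b \<mu> y :: real
  assumes null: "negligible {t. \<bar>flow a b \<mu> t 0 y\<bar> = 1}"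
  defines "h \<equiv> \<lambda>t. if \<bar>flow a b \<mu> t 0 y\<bar> < 1 then b else a"
  shows "h integrable_on {0..2 * pi}"
    and "(poincare_map a b \<mu> has_real_derivative exp (integral {0..2 * pi} h)) (at y)"
proof -
  define S where "S = {0..2 * pi} - {t. \<bar>flow a b \<mu> t 0 y\<bar> = 1}"
  have S: "negligible ({0..2 * pi} - S)" "S \<subseteq> {0..2 * pi}"
    unfolding S_def by (auto intro: negligible_subset[OF null])
  have same_int: "k integrable_on S \<longleftrightarrow> k integrable_on {0..2 * pi}"
    "integral S k = integral {0..2 * pi} k" for k :: "real \<Rightarrow> real"
    using S by (auto intro!: integrable_spike_set_eq integral_subset_negligible simp: Diff_eq_empty_iff[THEN iffD2])
  define g where "g = (\<lambda>x t. a + (b - a) * clip_slope (flow a b \<mu> t 0 x) (flow a b \<mu> t 0 y))"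
  have conv: "h integrable_on S \<and> (\<lambda>n. integral S (g (X n))) \<longlonglongrightarrow> integral S h"
    if X: "X \<longlonglongrightarrow> y" "\<And>n. X n \<noteq> y" for X
  proof -
    have int: "g (X n) integrable_on S" for n
      unfolding same_int g_def by (rule poincare_map_quotient(1)[OF X(2)])
    have const: "(\<lambda>_. \<bar>a\<bar> + \<bar>b - a\<bar>) integrable_on S"
      unfolding same_int by (rule integrable_const_ivl)
    have bound: "norm (g (X n) t) \<le> \<bar>a\<bar> + \<bar>b - a\<bar>" for n t
      using abs_slope_le by (simp add: g_def)
    have lim: "(\<lambda>n. g (X n) t) \<longlonglongrightarrow> h t" if "t \<in> S" for t
    proof -
      have "flow a b \<mu> t 0 (X n) \<noteq> flow a b \<mu> t 0 y" for n
        using solves_neq[OF solves_flow solves_flow, of a b \<mu> 0 0 "X n" 0 y t] X(2) by simp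
      from clip_slope_tendsto[OF flow_tendsto[OF X(1)] this] that
      have "(\<lambda>n. g (X n) t) \<longlonglongrightarrow> a + (b - a) * (if \<bar>flow a b \<mu> t 0 y\<bar> < 1 then 1 else 0)"
        unfolding g_def by (intro tendsto_intros) (simp add: S_def)
      then show ?thesis by (simp add: h_def if_distrib cong: if_cong)
    qed
    show ?thesis
      using dominated_convergence[of "\<lambda>n. g (X n)" S "\<lambda>_. \<bar>a\<bar> + \<bar>b - a\<bar>" h] int const bound lim by blast
  qed
  \<comment> \<open>Integrability of \<open>h\<close> comes out of dominated convergence, so one
    concrete sequence tending to y is needed.\<close>
  have "(\<lambda>n. y + inverse (real (Suc n))) \<longlonglongrightarrow> y"
    using tendsto_add[OF tendsto_const LIMSEQ_inverse_real_of_nat, of y] by simp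
  from conv[OF this] show "h integrable_on {0..2 * pi}"
    unfolding same_int by simp
  show "(poincare_map a b \<mu> has_real_derivative exp (integral {0..2 * pi} h)) (at y)"
    unfolding has_field_derivative_iff tendsto_at_iff_sequentially
  proof (intro allI impI)
    fix X assume X: "\<forall>i. X i \<in> UNIV - {y}" "X \<longlonglongrightarrow> y"
    then have "(\<lambda>n. exp (integral S (g (X n)))) \<longlonglongrightarrow> exp (integral S h)"
      using conv[of X] by (intro tendsto_exp) auto
    moreover have "(poincare_map a b \<mu> (X n) - poincare_map a b \<mu> y) / (X n - y)
        = exp (integral S (g (X n)))" for n
      unfolding same_int g_def using X(1) by (intro poincare_map_quotient(2)) auto
    ultimately show "((\<lambda>x. (poincare_map a b \<mu> x - poincare_map a b \<mu> y) / (x - y)) \<circ> X)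
        \<longlonglongrightarrow> exp (integral {0..2 * pi} h)"
      by (simp add: o_def same_int)
  qed
qed

text \<open>Where \<open>cos t \<noteq> 0\<close> the level is crossed with nonzero derivative; the
  remaining times are zeros of \<open>cos\<close>, at which its derivative \<open>- sin t\<close> is
  nonzero.\<close>

lemma negligible_sin_eq: "negligible {t::real. sin t = c}"
proof -
  have "negligible ({t::real. sin t = c \<and> cos t \<noteq> 0} \<union> {t::real. cos t = 0 \<and> - sin t \<noteq> 0})"
    by (intro negligible_Un negligible_level_set_of_nonzero_deriv) (auto intro!: derivative_eq_intros)
  moreover have "sin t \<noteq> 0" if "cos t = 0" for t :: real
    using sin_zero_abs_cos_one[of t] that by auto
  ultimately show ?thesis by (elim negligible_subset) auto
qed

text \<open>At a time on the level c, either the solution has nonzero derivative or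
  \<open>sin t\<close> equals the fixed number \<open>- pl_field a b c / \<mu>\<close>.\<close>

lemma solves_negligible_level_set:
  assumes v: "solves a b \<mu> v" and "\<mu> \<noteq> 0"
  shows "negligible {t. v t = c}"
proof -
  have "negligible ({t. v t = c \<and> pl_field a b (v t) + \<mu> * sin t \<noteq> 0} \<union> {t. sin t = - pl_field a b c / \<mu>})"
    using v unfolding solves_def
    by (intro negligible_Un negligible_level_set_of_nonzero_deriv negligible_sin_eq) auto
  then show ?thesis by (rule negligible_subset) (use assms(2) in \<open>auto simp: field_simps\<close>)
qed

section \<open>Solutions in the strip and growth of differences\<close>

lemma flow_eq_cos:
  assumes "\<And>t. pl_field a b (x + \<mu> - \<mu> * cos t) = 0"
  shows "flow a b \<mu> t 0 x = x + \<mu> - \<mu> * cos t"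
proof -
  have "solves a b \<mu> (\<lambda>t. x + \<mu> - \<mu> * cos t)"
    unfolding solves_def using assms by (auto intro!: derivative_eq_intros)
  from flow_eq[OF this, of t 0] show ?thesis by simp
qed

lemma pl_field_0_eq_0: "\<bar>x\<bar> \<le> 1 \<Longrightarrow> pl_field a 0 x = 0"
  by (auto simp: pl_field_def)

text \<open>For b = 0 the field vanishes in the strip, so \<open>v t + \<mu> * cos t\<close> is
  constant on \<open>[0, pi]\<close>. Hence \<open>v 0\<close> and
  \<open>v pi = v 0 + 2 * \<mu>\<close> both lie in \<open>[-1, 1]\<close>; their midpoint is
  \<open>v 0 + \<mu>\<close> and half their distance is \<open>\<bar>\<mu>\<bar>\<close>.\<close>

lemma solves_inner_strip:
  assumes v: "solves a 0 \<mu> v" and le: "\<And>t. 0 \<le> t \<Longrightarrow> t \<le> pi \<Longrightarrow> \<bar>v t\<bar> \<le> 1"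
  shows "\<bar>v 0 + \<mu>\<bar> + \<bar>\<mu>\<bar> \<le> 1"
proof -
  have d: "((\<lambda>t. v t + \<mu> * cos t) has_real_derivative 0) (at t)" if "0 \<le> t" "t \<le> pi" for t
  proof -
    have "(v has_real_derivative \<mu> * sin t) (at t)"
      using v pl_field_0_eq_0[OF le[OF that], of a] unfolding solves_def by (metis add_0)
    then show ?thesis by (auto intro!: derivative_eq_intros)
  qed
  have "v 0 + \<mu> * cos 0 \<le> v pi + \<mu> * cos pi"
    by (rule DERIV_nonneg_imp_nondecreasing) (use d in \<open>auto intro!: exI[of _ 0]\<close>)
  moreover have "v 0 + \<mu> * cos 0 \<ge> v pi + \<mu> * cos pi"
    by (rule DERIV_nonpos_imp_nonincreasing) (use d in \<open>auto intro!: exI[of _ 0]\<close>)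
  ultimately have "v pi = v 0 + 2 * \<mu>" by simp
  then show ?thesis using le[of 0] le[of pi] by auto
qed

lemma periodic_inner_strip:
  assumes "\<bar>x + \<mu>\<bar> + \<bar>\<mu>\<bar> \<le> 1"
  shows "displacement a 0 \<mu> x = 0"
proof -
  have "\<bar>x + \<mu> - \<mu> * cos t\<bar> \<le> 1" for t
  proof -
    have "\<bar>\<mu> * cos t\<bar> \<le> \<bar>\<mu>\<bar>" by (simp add: abs_mult mult_left_le)
    then show ?thesis using assms by linarith
  qed
  then show ?thesis
    using flow_eq_cos[OF pl_field_0_eq_0] by (simp add: displacement_eq_0_iff)
qed

lemma periodic_solutions_in_strip:
  assumes "a \<noteq> 0" and x: "displacement a 0 \<mu> x = 0" and y: "displacement a 0 \<mu> y = 0" and "x \<noteq> y"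
  shows "\<bar>x + \<mu>\<bar> + \<bar>\<mu>\<bar> \<le> 1"
proof -
  \<comment> \<open>Here \<sigma> = a is admissible, since \<open>a * a \<ge> 0\<close> and
    \<open>a * 0 = 0\<close>. With b = 0 the slope is \<open>a * (1 - q)\<close>, which forces q =
    1.\<close>
  have "a + (0 - a) * clip_slope (flow a 0 \<mu> t 0 x) (flow a 0 \<mu> t 0 y) = 0" for t
    by (rule periodic_solutions_slope_eq_0[where \<sigma> = a and \<mu> = \<mu> and s = 0])
      (use x y assms(1,4) in \<open>simp_all add: displacement_eq_0_iff solves_flow\<close>)
  then have "clip_slope (flow a 0 \<mu> t 0 x) (flow a 0 \<mu> t 0 y) = 1" for t
    using assms(1) by simp
  from clip_slope_eq_1D(1)[OF this] show ?thesis
    using solves_inner_strip[OF solves_flow, of a \<mu> 0 x] by simp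
qed

text \<open>In each period v stays within 1/2 of 0 for a fixed time \<eta> after its zero. There the
  \<sigma>-weighted square grows at rate at least c, and elsewhere it does not decrease. With
  \<sigma> = -1 this drives attraction, with \<sigma> = 1 repulsion.\<close>

lemma square_diff_growth:
  assumes \<sigma>: "\<sigma> * a \<ge> 0" "\<sigma> * b > 0" and uv: "solves a b \<mu> u" "solves a b \<mu> v"
    and per: "v (2 * pi) = v 0" and zero: "v t0 = 0" "t0 \<ge> 0"
    and L: "L > 0" "\<And>t. t \<ge> 0 \<Longrightarrow> \<bar>u t - v t\<bar> \<ge> L"
  obtains C where "C > 0"
    "\<And>n::nat. \<sigma> * (u (t0 + 2 * pi * n) - v (t0 + 2 * pi * n))\<^sup>2 \<ge> \<sigma> * (u t0 - v t0)\<^sup>2 + real n * C"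
proof -
  define W where "W = (\<lambda>t. \<sigma> * (u t - v t)\<^sup>2)"
  \<comment> \<open>The cap 1/2 is the range of L allowed in \<open>clip_slope_ge\<close>.\<close>
  define M where "M = min L (1/2)"
  have M: "0 < M" "M \<le> 1/2" "M \<le> L" using L(1) by (auto simp: M_def)
  have W_mono: "W s \<le> W t" if "s \<le> t" for s t
    using square_diff_mono[OF \<sigma>(1) less_imp_le[OF \<sigma>(2)] uv that] by (simp add: W_def)
  have "isCont v t0" using uv(2) unfolding solves_def by (blast intro: DERIV_isCont)
  then obtain \<delta> where \<delta>: "\<delta> > 0" "\<And>t. \<bar>t - t0\<bar> < \<delta> \<Longrightarrow> \<bar>v t\<bar> < 1/2"
    unfolding continuous_at_eps_delta using zero(1)
    by (auto simp: dist_real_def dest!: spec[where x = "1/2 :: real" and P = "\<lambda>e. e > 0 \<longrightarrow> _ e"])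
  \<comment> \<open>\<eta> < \<delta> keeps v small throughout the window, and \<eta> \<le> \<pi>
    ends the window before the next period starts.\<close>
  define \<eta> where "\<eta> = min (\<delta> / 2) pi"
  have \<eta>: "0 < \<eta>" "\<eta> < \<delta>" "\<eta> \<le> pi" using \<delta>(1) by (auto simp: \<eta>_def min_def)
  define c where "c = 2 * (\<sigma> * b) * M\<^sup>2"
  have c: "c > 0" using \<sigma>(2) M(1) by (simp add: c_def)
  have step: "W (t0 + 2 * pi * Suc n) \<ge> W (t0 + 2 * pi * n) + c * \<eta>" for n :: nat
  proof -
    let ?t = "t0 + 2 * pi * n"
    have "W ?t - c * ?t \<le> W (?t + \<eta>) - c * (?t + \<eta>)"
    proof (rule DERIV_nonneg_imp_nondecreasing[where f = "\<lambda>t. W t - c * t"])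
      fix r assume r: "?t \<le> r" "r \<le> ?t + \<eta>"
      have "v ((r - 2 * pi * n) + 2 * pi * n) = v (r - 2 * pi * n)" by (rule solves_periodic[OF uv(2) per])
      then have "\<bar>v r\<bar> \<le> 1/2" using \<delta>(2)[of "r - 2 * pi * n"] r \<eta> by (simp add: abs_if split: if_splits)
      moreover have "0 \<le> 2 * pi * n" by simp
      then have "M \<le> \<bar>u r - v r\<bar>" using L(2)[of r] M(3) zero(2) r by linarith
      ultimately have q: "M\<^sup>2 \<le> clip_slope (u r) (v r) * (u r - v r)\<^sup>2"
        by (intro clip_slope_ge M)
      have "c \<le> 2 * (\<sigma> * b) * (clip_slope (u r) (v r) * (u r - v r)\<^sup>2)"
        unfolding c_def using \<sigma>(2) by (intro mult_left_mono q) auto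
      also have "\<dots> = 2 * (\<sigma> * b * clip_slope (u r) (v r)) * (u r - v r)\<^sup>2" by (simp add: mult_ac)
      also have "\<dots> \<le> 2 * (\<sigma> * (a + (b - a) * clip_slope (u r) (v r))) * (u r - v r)\<^sup>2"
        using slope_nonneg(1)[OF \<sigma>(1) less_imp_le[OF \<sigma>(2)]] by (intro mult_right_mono mult_left_mono) auto
      also have "\<dots> = \<sigma> * (2 * (a + (b - a) * clip_slope (u r) (v r)) * (u r - v r)\<^sup>2)" by (simp add: mult_ac)
      finally have "0 \<le> \<sigma> * (2 * (a + (b - a) * clip_slope (u r) (v r)) * (u r - v r)\<^sup>2) - c" by simp
      moreover have "((\<lambda>t. W t - c * t) has_real_derivative
          \<sigma> * (2 * (a + (b - a) * clip_slope (u r) (v r)) * (u r - v r)\<^sup>2) - c) (at r)"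
        unfolding W_def
        by (intro DERIV_diff DERIV_cmult solves_square_diff_deriv[OF uv]) (auto intro!: derivative_eq_intros)
      ultimately show "\<exists>y. ((\<lambda>t. W t - c * t) has_real_derivative y) (at r) \<and> 0 \<le> y" by blast
    qed (use \<eta> in simp)
    then have "W ?t + c * \<eta> \<le> W (?t + \<eta>)" by (simp add: distrib_left)
    also have "\<dots> \<le> W (t0 + 2 * pi * Suc n)"
    proof (rule W_mono)
      have "\<eta> \<le> 2 * pi" using \<eta>(3) pi_gt_zero by linarith
      then show "?t + \<eta> \<le> t0 + 2 * pi * Suc n" by (simp add: distrib_left)
    qed
    finally show ?thesis .
  qed
  have "W (t0 + 2 * pi * n) \<ge> W t0 + real n * (c * \<eta>)" for n :: nat
  proof (induction n)
    case (Suc n)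
    then show ?case using step[of n] by (simp add: algebra_simps)
  qed simp
  then show thesis using that[of "c * \<eta>"] c \<eta>(1) by (simp add: W_def)
qed

section \<open>The symmetric periodic solution\<close>

lemma sign_exists:
  fixes a b :: real
  assumes "a * b \<ge> 0"
  obtains \<sigma> where "\<sigma> = 1 \<or> \<sigma> = -1" "\<sigma> * a \<ge> 0" "\<sigma> * b \<ge> 0"
proof (cases "a \<ge> 0 \<and> b \<ge> 0")
  case True
  then show thesis using that[of 1] by simp
next
  case False
  then have "a \<le> 0" "b \<le> 0" using assms by (auto simp: zero_le_mult_iff)
  then show thesis using that[of "-1"] by simp
qed

lemma periodic_unique:
  assumes ab: "a * b \<ge> 0" and ne: "\<not> (a = 0 \<and> b = 0)" "\<not> (b = 0 \<and> \<bar>\<mu>\<bar> < 1)"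
    and x: "half_map a b \<mu> x = x" and y: "displacement a b \<mu> y = 0"
  shows "y = x"
proof (rule ccontr)
  assume "y \<noteq> x"
  have x': "displacement a b \<mu> x = 0"
    using half_map_fixed_point_periodic[OF x] by (simp add: displacement_eq_0_iff)
  show False
  proof (cases "b = 0")
    case True
    then have "\<bar>x + \<mu>\<bar> + \<bar>\<mu>\<bar> \<le> 1" "\<bar>y + \<mu>\<bar> + \<bar>\<mu>\<bar> \<le> 1"
      using periodic_solutions_in_strip[of a \<mu> x y] periodic_solutions_in_strip[of a \<mu> y x] ne x' y \<open>y \<noteq> x\<close> by auto
    \<comment> \<open>What remains is \<open>\<bar>\<mu>\<bar> \<ge> 1\<close>, so the two strip
      bounds force both x and y to equal \<open>- \<mu>\<close>.\<close>
    then show False using True ne(2) \<open>y \<noteq> x\<close> by auto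
  next
    case False
    obtain \<sigma> where \<sigma>: "\<sigma> = 1 \<or> \<sigma> = -1" "\<sigma> * a \<ge> 0" "\<sigma> * b \<ge> 0" using sign_exists[OF ab] .
    obtain t where t: "flow a b \<mu> t 0 x = 0" using half_map_fixed_point_zero[OF x] .
    define q where "q = clip_slope (flow a b \<mu> t 0 y) (flow a b \<mu> t 0 x)"
    have eq: "a + (b - a) * q = 0" unfolding q_def
      by (rule periodic_solutions_slope_eq_0[where \<sigma> = \<sigma> and \<mu> = \<mu> and s = 0])
        (use x' y \<sigma> \<open>y \<noteq> x\<close> in \<open>auto simp: displacement_eq_0_iff solves_flow\<close>)
    \<comment> \<open>With \<sigma> b > 0 this leaves only q = 0, and at a zero of the symmetric
      solution that makes the other solution vanish too, against uniqueness.\<close>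
    have "\<sigma> * b * q \<le> \<sigma> * (a + (b - a) * q)" unfolding q_def by (rule slope_nonneg(1)[OF \<sigma>(2,3)])
    then have "\<sigma> * b * q \<le> 0" by (simp add: eq)
    moreover have "\<sigma> * b > 0" "q \<ge> 0"
      using \<sigma> False clip_slope_bounds(1) by (auto simp: q_def less_le)
    ultimately have "q = 0" by (metis less_le mult_pos_pos not_le)
    then have "flow a b \<mu> t 0 y = 0" using clip_slope_eq_0D t by (simp add: q_def)
    then show False
      using solves_neq[OF solves_flow solves_flow, of a b \<mu> 0 0 y 0 x t] \<open>y \<noteq> x\<close> t by simp
  qed
qed

section \<open>Centers\<close>

lemma global_center_iff:
  assumes ab: "a * b \<ge> 0"
  shows "has_global_center a b \<mu> \<longleftrightarrow> a = 0 \<and> b = 0"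
proof
  assume "a = 0 \<and> b = 0"
  then show "has_global_center a b \<mu>"
    by (simp add: has_global_center_def displacement_eq_0_iff flow_eq_cos pl_field_def)
next
  assume "has_global_center a b \<mu>"
  then have all: "displacement a b \<mu> x = 0" for x by (simp add: has_global_center_def)
  obtain x where x: "half_map a b \<mu> x = x" using half_map_fixed_point by blast
  show "a = 0 \<and> b = 0"
  proof (rule ccontr)
    assume ne: "\<not> (a = 0 \<and> b = 0)"
    show False
    proof (cases "b = 0 \<and> \<bar>\<mu>\<bar> < 1")
      case True
      \<comment> \<open>The value 2 violates the strip bound, as
        \<open>\<bar>2 + \<mu>\<bar> + \<bar>\<mu>\<bar> \<ge> 2\<close>; 3 merely serves as a
        second periodic value.\<close>
      then show False
        using periodic_solutions_in_strip[of a \<mu> 2 3] all ne by auto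
    next
      case False
      then show False using periodic_unique[OF ab ne False x all, of "x + 1"] by simp
    qed
  qed
qed

text \<open>All points within \<open>1 - \<bar>\<mu>\<bar>\<close> of \<open>- \<mu>\<close> are
  zeros of the displacement. For a \<noteq> 0 there are no others, and a nondegenerate interval has
  no isolated point.\<close>

lemma center_no_limit_cycle:
  assumes "\<bar>\<mu>\<bar> < 1"
  shows "has_center a 0 \<mu>" "\<not> limit_cycle a 0 \<mu> v"
proof -
  have "- \<mu> - (1 - \<bar>\<mu>\<bar>) < - \<mu> + (1 - \<bar>\<mu>\<bar>)" using assms by simp
  moreover have "displacement a 0 \<mu> x = 0" if "x \<in> {- \<mu> - (1 - \<bar>\<mu>\<bar>)<..<- \<mu> + (1 - \<bar>\<mu>\<bar>)}" for x
    by (rule periodic_inner_strip) (use that in auto)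
  ultimately show "has_center a 0 \<mu>" unfolding has_center_def by blast
  show "\<not> limit_cycle a 0 \<mu> v"
  proof
    assume "limit_cycle a 0 \<mu> v"
    then obtain x e where x: "displacement a 0 \<mu> x = 0" and e: "e > 0"
      "\<And>y. displacement a 0 \<mu> y = 0 \<Longrightarrow> \<bar>x - y\<bar> < e \<Longrightarrow> y = x"
      by (auto simp: limit_cycle_def isolated_in_dist_Ex_iff dist_real_def)
    show False
    proof (cases "a = 0")
      case True
      then have "displacement a 0 \<mu> (x + e / 2) = 0"
        using global_center_iff[of a 0 \<mu>] by (simp add: has_global_center_def)
      then show False using e(2)[of "x + e / 2"] e(1) by simp
    next
      case False
      have "displacement a 0 \<mu> (- \<mu>) = 0" using assms by (intro periodic_inner_strip) simp
      then have strip: "\<bar>x + \<mu>\<bar> + \<bar>\<mu>\<bar> \<le> 1"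
        using periodic_solutions_in_strip[OF False x, of "- \<mu>"] assms by (cases "x = - \<mu>") auto
      define d where "d = min (e / 2) (1 - \<bar>\<mu>\<bar>)"
      have d: "0 < d" "d < e" "d \<le> 1 - \<bar>\<mu>\<bar>" using assms e(1) by (auto simp: d_def)
      \<comment> \<open>Moving x towards the centre \<open>- \<mu>\<close> by at most the radius of
        the interval stays inside it, even if the centre is passed.\<close>
      define y where "y = (if x \<le> - \<mu> then x + d else x - d)"
      have "\<bar>y + \<mu>\<bar> + \<bar>\<mu>\<bar> \<le> 1" 
      proof (cases "x \<le> - \<mu>")
        case True
        then have "y = x + d" "\<bar>x + \<mu>\<bar> = - (x + \<mu>)" by (simp_all add: y_def)
        then show ?thesis using d strip by linarith
      next
        case False
        then have "y = x - d" "\<bar>x + \<mu>\<bar> = x + \<mu>" by (simp_all add: y_def)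
        then show ?thesis using d strip by linarith
      qed
      then have "displacement a 0 \<mu> y = 0" by (rule periodic_inner_strip)
      moreover have "\<bar>x - y\<bar> < e" "y \<noteq> x" using d by (simp_all add: y_def)
      ultimately show False using e(2) by blast
    qed
  qed
qed

section \<open>Hyperbolicity and stability of the symmetric solution\<close>

lemma symmetric_negligible_switching:
  assumes ne: "b \<noteq> 0 \<or> \<bar>\<mu>\<bar> \<ge> 1" and x: "half_map a b \<mu> x = x"
  shows "negligible {t. \<bar>flow a b \<mu> t 0 x\<bar> = 1}"
proof (cases "\<mu> = 0")
  case True
  \<comment> \<open>Without forcing, the symmetric solution is the zero solution, which never meets
    a corner.\<close>
  then have "solves a b \<mu> (\<lambda>_. 0)" by (simp add: solves_def pl_field_def)
  from flow_eq[OF this] have zero: "flow a b \<mu> t 0 0 = 0" for t .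
  then have "half_map a b \<mu> 0 = 0" by (simp add: half_map_def)
  then have "x = 0" using half_map_fixed_point[of a b \<mu>] x by blast
  then show ?thesis using zero by simp
next
  case False
  have "negligible ({t. flow a b \<mu> t 0 x = 1} \<union> {t. flow a b \<mu> t 0 x = -1})"
    by (intro negligible_Un solves_negligible_level_set[OF solves_flow False])
  then show ?thesis by (rule negligible_subset) auto
qed

text \<open>The integrand \<open>h\<close> takes only the values a and b, so \<sigma> h \<ge> 0 and
  the integral is nonzero once \<open>h\<close> is a nonzero constant on some interval: b near a
  zero, or a outside the strip when b = 0. For b = 0 and \<open>\<bar>\<mu>\<bar> = 1\<close> the
  solution is \<open>- \<mu> * cos t\<close>, which stays in the strip, and the derivative is
  1.\<close>

lemma symmetric_hyperbolic:
  assumes ab: "a * b \<ge> 0" and ne: "\<not> (a = 0 \<and> b = 0)" "b \<noteq> 0 \<or> \<bar>\<mu>\<bar> > 1" and x: "half_map a b \<mu> x = x"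
  shows "hyperbolic a b \<mu> (\<lambda>t. flow a b \<mu> t 0 x)"
proof -
  define v where "v = (\<lambda>t. flow a b \<mu> t 0 x)"
  have v: "solves a b \<mu> v" unfolding v_def by (rule solves_flow)
  define h where "h = (\<lambda>t. if \<bar>v t\<bar> < 1 then b else a)"
  have null: "negligible {t. \<bar>flow a b \<mu> t 0 x\<bar> = 1}"
    using symmetric_negligible_switching[OF _ x] ne(2) by auto
  have int: "h integrable_on {0..2 * pi}"
    and der: "(poincare_map a b \<mu> has_real_derivative exp (integral {0..2 * pi} h)) (at x)"
    using poincare_map_has_derivative[OF null] by (simp_all add: h_def v_def)
  obtain \<sigma> where \<sigma>: "\<sigma> = 1 \<or> \<sigma> = -1" "\<sigma> * a \<ge> 0" "\<sigma> * b \<ge> 0" using sign_exists[OF ab] .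
  have "\<exists>t c I. 0 \<le> t \<and> t \<le> pi \<and> v t \<in> I \<and> open I \<and> c \<noteq> 0 \<and> (\<forall>s. v s \<in> I \<longrightarrow> h s = c) \<and> \<sigma> * c \<ge> 0"
  proof (cases "b = 0")
    case False
    obtain t where "0 \<le> t" "t \<le> pi" "v t = 0"
      using half_map_fixed_point_zero[OF x] by (auto simp: v_def)
    then show ?thesis using False \<sigma>(3)
      by (rule_tac exI[of _ t], rule_tac exI[of _ b], rule_tac exI[of _ "{-1<..<1}"]) (auto simp: h_def)
  next
    case True
    \<comment> \<open>Remaining in the strip for half a period would give
      \<open>\<bar>\<mu>\<bar> \<le> 1\<close>.\<close>
    have "\<exists>t. 0 \<le> t \<and> t \<le> pi \<and> \<bar>v t\<bar> > 1"
    proof (rule ccontr)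
      assume "\<not> ?thesis"
      then have "\<bar>v 0 + \<mu>\<bar> + \<bar>\<mu>\<bar> \<le> 1"
        using True v by (intro solves_inner_strip[of a \<mu> v]) (auto simp: not_less)
      then show False using ne(2) True by linarith
    qed
    then obtain t where "0 \<le> t" "t \<le> pi" "\<bar>v t\<bar> > 1" by blast
    moreover from this have "v t > 1 \<or> v t < -1" by linarith
    ultimately show ?thesis using True \<sigma>(2) ne(1)
      by (rule_tac exI[of _ t], rule_tac exI[of _ a], rule_tac exI[of _ "{1<..} \<union> {..<-1}"]) (auto simp: h_def)
  qed
  then obtain t c I where t: "0 \<le> t" "t \<le> pi" "v t \<in> I" "open I"
    and c: "c \<noteq> 0" "\<And>s. v s \<in> I \<Longrightarrow> h s = c" "\<sigma> * c \<ge> 0" by blast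
  have "open (v -` I)"
    using t(4) solves_continuous_on[OF v] by (simp add: open_vimage)
  then obtain e where e: "e > 0" "\<And>s. \<bar>s - t\<bar> < e \<Longrightarrow> v s \<in> I"
    using t(3) by (auto simp: open_dist dist_real_def)
  define d where "d = min (e / 2) pi"
  have d: "0 < d" "d < e" "d \<le> pi" using e(1) by (auto simp: d_def min_def)
  have hc: "h s = c" if "s \<in> {t..t + d}" for s
    using that d by (intro c(2) e(2)) auto
  have sub: "{t..t + d} \<subseteq> {0..2 * pi}" using t d by auto
  have "(h has_integral c * d) {t..t + d}"
    using has_integral_const_real[of c t "t + d"] d
    by (subst has_integral_cong[OF hc]) (auto simp: mult.commute)
  then have "((\<lambda>s. \<sigma> * h s) has_integral \<sigma> * (c * d)) {t..t + d}" by (rule has_integral_mult_right)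
  moreover have "((\<lambda>s. \<sigma> * h s) has_integral \<sigma> * integral {0..2 * pi} h) {0..2 * pi}"
    using int by (intro has_integral_mult_right) (simp add: has_integral_integral)
  ultimately have "\<sigma> * (c * d) \<le> \<sigma> * integral {0..2 * pi} h"
    by (rule has_integral_subset_le[OF sub]) (use \<sigma> in \<open>auto simp: h_def\<close>)
  moreover have "\<sigma> * c > 0" using c \<sigma>(1) by (auto simp: less_le)
  then have "\<sigma> * c * d > 0" using d(1) by (rule mult_pos_pos)
  ultimately have "integral {0..2 * pi} h \<noteq> 0" by (auto simp: mult.assoc)
  then have "exp (integral {0..2 * pi} h) \<noteq> 1" by simp
  moreover have "periodic_solution a b \<mu> (\<lambda>t. flow a b \<mu> t 0 x)"
    using half_map_fixed_point_periodic[OF x] by (auto simp: periodic_solution_def displacement_eq_0_iff)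
  ultimately show ?thesis unfolding hyperbolic_def using der by auto
qed

text \<open>Distances to v never increase, so \<delta> = \<epsilon> gives stability and one time of
  closeness suffices for attraction. If the distance stayed at least \<epsilon>, the negative of its
  square would grow without bound although it is at most 0.\<close>

lemma symmetric_globally_asymptotically_stable:
  assumes ab: "a * b \<ge> 0" and b: "b < 0" and x: "half_map a b \<mu> x = x"
  shows "globally_asymptotically_stable a b \<mu> (\<lambda>t. flow a b \<mu> t 0 x)"
proof -
  define v where "v = (\<lambda>t. flow a b \<mu> t 0 x)"
  have v: "solves a b \<mu> v" unfolding v_def by (rule solves_flow)
  have \<sigma>: "(-1) * a \<ge> 0" "(-1) * b > 0" using ab b by (auto simp: zero_le_mult_iff)
  have contract: "\<bar>flow a b \<mu> t \<tau> y - v t\<bar> \<le> \<bar>flow a b \<mu> s \<tau> y - v s\<bar>" if "s \<le> t" for s t \<tau> y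
    using square_diff_mono[OF \<sigma>(1) less_imp_le[OF \<sigma>(2)] solves_flow v that, of \<tau> y]
    by (simp add: abs_le_square_iff)
  have "lyapunov_stable a b \<mu> v"
    unfolding lyapunov_stable_def
  proof (intro allI impI)
    fix \<tau> \<epsilon> :: real assume "\<epsilon> > 0"
    then show "\<exists>\<delta>>0. \<forall>x. \<bar>x - v \<tau>\<bar> < \<delta> \<longrightarrow> (\<forall>t\<ge>\<tau>. \<bar>flow a b \<mu> t \<tau> x - v t\<bar> < \<epsilon>)"
      using contract[of \<tau> _ \<tau>] by (auto intro!: exI[of _ \<epsilon>] intro: le_less_trans)
  qed
  moreover have "((\<lambda>t. flow a b \<mu> t \<tau> y - v t) \<longlongrightarrow> 0) at_top" for \<tau> y
  proof (rule tendstoI)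
    fix \<epsilon> :: real assume \<epsilon>: "\<epsilon> > 0"
    have "\<exists>T\<ge>0. \<bar>flow a b \<mu> T \<tau> y - v T\<bar> < \<epsilon>"
    proof (rule ccontr)
      assume "\<not> ?thesis"
      then have far: "\<bar>flow a b \<mu> t \<tau> y - v t\<bar> \<ge> \<epsilon>" if "t \<ge> 0" for t using that by (auto simp: not_less)
      obtain t0 where t0: "t0 \<ge> 0" "v t0 = 0" using half_map_fixed_point_zero[OF x] by (auto simp: v_def)
      have per: "v (2 * pi) = v 0" using half_map_fixed_point_periodic[OF x] by (simp add: v_def)
      obtain C where C: "C > 0" "\<And>n::nat. (-1) * (flow a b \<mu> (t0 + 2 * pi * n) \<tau> y - v (t0 + 2 * pi * n))\<^sup>2
          \<ge> (-1) * (flow a b \<mu> t0 \<tau> y - v t0)\<^sup>2 + real n * C"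
        by (rule square_diff_growth[OF \<sigma> solves_flow v per t0(2,1) \<epsilon> far], assumption) (rule that)
      obtain n :: nat where "(flow a b \<mu> t0 \<tau> y - v t0)\<^sup>2 < real n * C"
        using ex_less_of_nat_mult[OF C(1)] by blast
      then show False
        using C(2)[of n] zero_le_power2[of "flow a b \<mu> (t0 + 2 * pi * n) \<tau> y - v (t0 + 2 * pi * n)"] by linarith
    qed
    then obtain T where "\<bar>flow a b \<mu> T \<tau> y - v T\<bar> < \<epsilon>" by blast
    then have "\<forall>t\<ge>T. dist (flow a b \<mu> t \<tau> y - v t) 0 < \<epsilon>"
      by (auto simp: dist_real_def intro: le_less_trans[OF contract])
    then show "\<forall>\<^sub>F t in at_top. dist (flow a b \<mu> t \<tau> y - v t) 0 < \<epsilon>"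
      unfolding eventually_at_top_linorder by blast
  qed
  ultimately show ?thesis by (simp add: globally_asymptotically_stable_def v_def)
qed

text \<open>A start at distance \<delta>/2 never comes closer, so the squared distance gains a fixed
  amount per period and cannot stay below 1. Stability thus already fails for \<tau> = 0 and
  \<epsilon> = 1.\<close>

lemma symmetric_unstable:
  assumes ab: "a * b \<ge> 0" and b: "b > 0" and x: "half_map a b \<mu> x = x"
  shows "unstable a b \<mu> (\<lambda>t. flow a b \<mu> t 0 x)"
  unfolding unstable_def
proof
  define v where "v = (\<lambda>t. flow a b \<mu> t 0 x)"
  have v: "solves a b \<mu> v" unfolding v_def by (rule solves_flow)
  have \<sigma>: "1 * a \<ge> 0" "1 * b > 0" using ab b by (auto simp: zero_le_mult_iff)
  assume "lyapunov_stable a b \<mu> (\<lambda>t. flow a b \<mu> t 0 x)"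
  then have "\<exists>\<delta>>0. \<forall>x. \<bar>x - v 0\<bar> < \<delta> \<longrightarrow> (\<forall>t\<ge>0. \<bar>flow a b \<mu> t 0 x - v t\<bar> < 1)"
    unfolding lyapunov_stable_def v_def by (metis zero_less_one)
  then obtain \<delta> where \<delta>: "\<delta> > 0"
    "\<And>y t. \<bar>y - v 0\<bar> < \<delta> \<Longrightarrow> t \<ge> 0 \<Longrightarrow> \<bar>flow a b \<mu> t 0 y - v t\<bar> < 1" by blast
  define u where "u = (\<lambda>t. flow a b \<mu> t 0 (v 0 + \<delta> / 2))"
  have u: "solves a b \<mu> u" unfolding u_def by (rule solves_flow)
  have near: "\<bar>u t - v t\<bar> < 1" if "t \<ge> 0" for t
    using \<delta>(2)[of "v 0 + \<delta> / 2" t] \<delta>(1) that by (simp add: u_def)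
  have far: "\<bar>u t - v t\<bar> \<ge> \<delta> / 2" if "t \<ge> 0" for t
  proof -
    have "\<bar>u 0 - v 0\<bar> \<le> \<bar>u t - v t\<bar>"
      using square_diff_mono[OF \<sigma>(1) less_imp_le[OF \<sigma>(2)] u v that] by (simp add: abs_le_square_iff)
    then show ?thesis using \<delta>(1) by (simp add: u_def)
  qed
  obtain t0 where t0: "t0 \<ge> 0" "v t0 = 0" using half_map_fixed_point_zero[OF x] by (auto simp: v_def)
  have per: "v (2 * pi) = v 0" using half_map_fixed_point_periodic[OF x] by (simp add: v_def)
  have \<delta>2: "\<delta> / 2 > 0" using \<delta>(1) by simp
  obtain C where C: "C > 0" "\<And>n::nat. 1 * (u (t0 + 2 * pi * n) - v (t0 + 2 * pi * n))\<^sup>2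
      \<ge> 1 * (u t0 - v t0)\<^sup>2 + real n * C"
    by (rule square_diff_growth[OF \<sigma> u v per t0(2,1) \<delta>2 far], assumption) (rule that)
  obtain n :: nat where n: "1 < real n * C" using ex_less_of_nat_mult[OF C(1)] by blast
  have "(u (t0 + 2 * pi * n) - v (t0 + 2 * pi * n))\<^sup>2 < 1"
    using near[of "t0 + 2 * pi * n"] t0(1) by (simp add: abs_square_less_1)
  then show False using C(2)[of n] n zero_le_power2[of "u t0 - v t0"] by linarith
qed

theorem theorem3p1:
  fixes a b \<mu> :: real
  assumes "a * b \<ge> 0"
  shows "(has_global_center a b \<mu> \<longleftrightarrow> a = 0 \<and> b = 0) \<and>
    (b = 0 \<and> \<bar>\<mu>\<bar> < 1 \<longrightarrow>
      has_center a b \<mu> \<and> \<not> (\<exists>v. limit_cycle a b \<mu> v)) \<and>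
    (\<not> (a = 0 \<and> b = 0) \<and> \<not> (b = 0 \<and> \<bar>\<mu>\<bar> < 1) \<longrightarrow>
      (\<exists>us. (\<forall>v. symmetric_periodic_solution a b \<mu> v \<longleftrightarrow> v = us) \<and>
            (\<forall>v. limit_cycle a b \<mu> v \<longleftrightarrow> v = us) \<and>
            (b \<noteq> 0 \<or> \<bar>\<mu>\<bar> \<noteq> 1 \<longrightarrow> hyperbolic a b \<mu> us) \<and>
            (b < 0 \<longrightarrow> globally_asymptotically_stable a b \<mu> us) \<and>
            (b > 0 \<longrightarrow> unstable a b \<mu> us)))"
proof (intro conjI)
  show "has_global_center a b \<mu> \<longleftrightarrow> a = 0 \<and> b = 0" by (rule global_center_iff[OF assms])
  show "b = 0 \<and> \<bar>\<mu>\<bar> < 1 \<longrightarrow> has_center a b \<mu> \<and> \<not> (\<exists>v. limit_cycle a b \<mu> v)"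
    using center_no_limit_cycle by blast
  show "\<not> (a = 0 \<and> b = 0) \<and> \<not> (b = 0 \<and> \<bar>\<mu>\<bar> < 1) \<longrightarrow>
      (\<exists>us. (\<forall>v. symmetric_periodic_solution a b \<mu> v \<longleftrightarrow> v = us) \<and>
            (\<forall>v. limit_cycle a b \<mu> v \<longleftrightarrow> v = us) \<and>
            (b \<noteq> 0 \<or> \<bar>\<mu>\<bar> \<noteq> 1 \<longrightarrow> hyperbolic a b \<mu> us) \<and>
            (b < 0 \<longrightarrow> globally_asymptotically_stable a b \<mu> us) \<and>
            (b > 0 \<longrightarrow> unstable a b \<mu> us))"
  proof
    assume "\<not> (a = 0 \<and> b = 0) \<and> \<not> (b = 0 \<and> \<bar>\<mu>\<bar> < 1)"
    then have ne: "\<not> (a = 0 \<and> b = 0)" "\<not> (b = 0 \<and> \<bar>\<mu>\<bar> < 1)" by blast+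
    obtain x where x: "half_map a b \<mu> x = x" using half_map_fixed_point[of a b \<mu>] by blast
    have x_unique: "y = x" if "half_map a b \<mu> y = y" for y
      using half_map_fixed_point[of a b \<mu>] x that by blast
    have zeros: "{y. displacement a b \<mu> y = 0} = {x}"
    proof (intro set_eqI iffI)
      fix y assume "y \<in> {y. displacement a b \<mu> y = 0}"
      then show "y \<in> {x}" using periodic_unique[OF assms ne x] by simp
    next
      fix y assume "y \<in> {x}"
      then show "y \<in> {y. displacement a b \<mu> y = 0}"
        using half_map_fixed_point_periodic[OF x] by (simp add: displacement_eq_0_iff)
    qed
    show "\<exists>us. (\<forall>v. symmetric_periodic_solution a b \<mu> v \<longleftrightarrow> v = us) \<and>
            (\<forall>v. limit_cycle a b \<mu> v \<longleftrightarrow> v = us) \<and>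
            (b \<noteq> 0 \<or> \<bar>\<mu>\<bar> \<noteq> 1 \<longrightarrow> hyperbolic a b \<mu> us) \<and>
            (b < 0 \<longrightarrow> globally_asymptotically_stable a b \<mu> us) \<and>
            (b > 0 \<longrightarrow> unstable a b \<mu> us)"
    proof (intro exI[of _ "\<lambda>t. flow a b \<mu> t 0 x"] conjI)
      show "\<forall>v. symmetric_periodic_solution a b \<mu> v \<longleftrightarrow> v = (\<lambda>t. flow a b \<mu> t 0 x)"
        unfolding symmetric_periodic_solution_def using x x_unique by blast
      \<comment> \<open>The only zero of the displacement is x, and it is isolated because a finite
        set has no limit points.\<close>
      show "\<forall>v. limit_cycle a b \<mu> v \<longleftrightarrow> v = (\<lambda>t. flow a b \<mu> t 0 x)"
        unfolding limit_cycle_def zeros isolated_in_islimpt_iff using islimpt_finite[of "{x}"] by blast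
      show "b \<noteq> 0 \<or> \<bar>\<mu>\<bar> \<noteq> 1 \<longrightarrow> hyperbolic a b \<mu> (\<lambda>t. flow a b \<mu> t 0 x)"
      proof
        assume "b \<noteq> 0 \<or> \<bar>\<mu>\<bar> \<noteq> 1"
        \<comment> \<open>When b = 0, the case hypothesis gives
          \<open>\<bar>\<mu>\<bar> \<ge> 1\<close>, so excluding equality leaves the strict
          inequality.\<close>
        then have "b \<noteq> 0 \<or> \<bar>\<mu>\<bar> > 1" using ne(2) by linarith
        from symmetric_hyperbolic[OF assms ne(1) this x]
        show "hyperbolic a b \<mu> (\<lambda>t. flow a b \<mu> t 0 x)" .
      qed
    qed (use symmetric_globally_asymptotically_stable[OF assms _ x] symmetric_unstable[OF assms _ x] in auto)
  qed
qed

end
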